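(* Let $\Theta$ be a finite set, $1\le T\le\infty$, and let $\mu\in\operatorname{int}\Delta(\Theta)$ be a prior. Let $\pi_1$ and $\pi_2$ be two dynamic information structures with horizon $T$, inducing at prior $\mu$ the sequences $(F_t)_{t=1}^T$ and $(G_t)_{t=1}^T$, respectively, of period-$t$ distributions over posteriors. Then $\pi_1$ dominates $\pi_2$ in the class of additively separable (AS) problems, i.e. $W(\pi_1)\ge W(\pi_2)$ for every AS problem with state space $\Theta$ and horizon $T$, if and only if $F_t\succeq G_t$ for every period $t$.
   Context: Periods are $t\in\{1,\dots,T\}$ (all positive integers if $T=\infty$). $\Delta(X)$ denotes the probability measures on $X$. Dynamic information structure: compact signal spaces $S_1,\dots,S_T$ and a stochastic map $\pi:\Theta\to\Delta(S)$, $S=\prod_t S_t$. The agent observes $s_t\in S_t$ in period $t$ before acting, so in period $t$ she knows $s^t=(s_1,\dots,s_t)$. With $\theta\sim\mu$ and $s\mid\theta\sim\pi(\cdot\mid\theta)$, the period-$t$ distribution over posteriors, an element of $\Delta(\Delta(\Theta))$, is the law of the posterior belief about $\theta$ conditional on $s^t$. AS problem: nonempty compact action sets $A_t$ and continuous $u_t:A_t\times\Theta\to\mathbb{R}$, one for each $t$, such that the total utility $u(a,\theta)=\sum_{t=1}^T u_t(a_t,\theta)$ is a finite (convergent) sum for all $a\in\prod_t A_t$, $\theta\in\Theta$. Value of a signal: put $V_t(x)=\max_{a_t\in A_t}\sum_{\theta}x(\theta)u_t(a_t,\theta)$ for $x\in\Delta(\Theta)$. The agent's optimal ex ante expected utility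 under a structure $\pi$ with period-$t$ posterior distributions $F_t$ is $W(\pi)=\sum_{t=1}^T\mathbb{E}_{x\sim F_t}[V_t(x)]$. $F\succeq G$, for $F,G\in\Delta(\Delta(\Theta))$, means that $F$ is a mean-preserving spread of $G$: there are random vectors $X\sim F$, $Y\sim G$ on a common probability space with $\mathbb{E}[X\mid Y]=Y$ (equivalently, $\mathbb{E}_F\varphi\ge\mathbb{E}_G\varphi$ for every continuous convex $\varphi:\Delta(\Theta)\to\mathbb{R}$). *)

theory Defs
  imports "HOL-Probability.Probability"
begin

definition periods :: "enat \<Rightarrow> nat set" where
  "periods T = {t. 1 \<le> t \<and> enat t \<le> T}"

text \<open>For \<open>T = \<infinity>\<close> this is the limit of partial sums, taken in the order of the periods.\<close>

definition period_summable :: "enat \<Rightarrow> (nat \<Rightarrow> real) \<Rightarrow> bool" where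
  "period_summable T f \<longleftrightarrow> summable (\<lambda>t. if t \<in> periods T then f t else 0)"

definition period_sum :: "enat \<Rightarrow> (nat \<Rightarrow> real) \<Rightarrow> real" where
  "period_sum T f = (\<Sum>t. if t \<in> periods T then f t else 0)"

text \<open>The finite state space \<open>\<Theta>\<close> is the index type \<open>'n\<close>.\<close>

definition beliefs :: "(real ^ 'n) set" where
  "beliefs = {x. (\<forall>\<theta>. 0 \<le> x $ \<theta>) \<and> (\<Sum>\<theta>\<in>UNIV. x $ \<theta>) = 1}"

definition borel_of_topology :: "'s topology \<Rightarrow> 's measure" where
  "borel_of_topology X = sigma (topspace X) {U. openin X U}"

text \<open>Signal paths carry the product of the Borel \<open>\<sigma>\<close>-algebras, i.e. the \<open>\<sigma>\<close>-algebra
  generated by the coordinates. It coincides with the Borel \<open>\<sigma>\<close>-algebra of the product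
  topology when the signal spaces are metrizable. In general a Borel measure on the product
  restricts to it, and since knowing \<open>s\<^sub>1, \<dots>, s\<^sub>t\<close> means knowing the \<open>\<sigma>\<close>-algebra generated by
  these coordinates, the restriction has the same posteriors.\<close>

definition signal_paths :: "nat set \<Rightarrow> (nat \<Rightarrow> 's topology) \<Rightarrow> (nat \<Rightarrow> 's) measure" where
  "signal_paths I S = (\<Pi>\<^sub>M t\<in>I. borel_of_topology (S t))"

definition dynamic_info_structure ::
    "enat \<Rightarrow> (nat \<Rightarrow> 's topology) \<Rightarrow> ('n \<Rightarrow> (nat \<Rightarrow> 's) measure) \<Rightarrow> bool" where
  "dynamic_info_structure T S \<pi> \<longleftrightarrow>
     (\<forall>t\<in>periods T. compact_space (S t)) \<and>
     (\<forall>\<theta>. \<pi> \<theta> \<in> space (prob_algebra (signal_paths (periods T) S)))"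

definition joint_law ::
    "enat \<Rightarrow> real ^ 'n \<Rightarrow> (nat \<Rightarrow> 's topology) \<Rightarrow> ('n \<Rightarrow> (nat \<Rightarrow> 's) measure) \<Rightarrow>
     ('n \<times> (nat \<Rightarrow> 's)) measure" where
  "joint_law T \<mu> S \<pi> =
     point_measure UNIV (\<lambda>\<theta>. ennreal (\<mu> $ \<theta>)) \<bind>
     (\<lambda>\<theta>. distr (\<pi> \<theta>) (count_space UNIV \<Otimes>\<^sub>M signal_paths (periods T) S) (\<lambda>s. (\<theta>, s)))"

definition history_algebra ::
    "enat \<Rightarrow> (nat \<Rightarrow> 's topology) \<Rightarrow> nat \<Rightarrow> ('n \<times> (nat \<Rightarrow> 's)) measure" where
  "history_algebra T S t =
     vimage_algebra (UNIV \<times> space (signal_paths (periods T) S))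
       (\<lambda>(\<theta>, s). restrict s {1..t}) (signal_paths {1..t} S)"

text \<open>The components are versions of the conditional probabilities of the states, so the posterior
  lies in \<open>beliefs\<close> almost surely; its law is therefore a Borel measure on \<open>real ^ 'n\<close> that gives
  \<open>beliefs\<close> probability one.\<close>

definition posterior ::
    "enat \<Rightarrow> real ^ 'n \<Rightarrow> (nat \<Rightarrow> 's topology) \<Rightarrow> ('n \<Rightarrow> (nat \<Rightarrow> 's) measure) \<Rightarrow> nat \<Rightarrow>
     'n \<times> (nat \<Rightarrow> 's) \<Rightarrow> real ^ 'n" where
  "posterior T \<mu> S \<pi> t \<omega> =
     (\<chi> \<theta>. real_cond_exp (joint_law T \<mu> S \<pi>) (history_algebra T S t)
              (\<lambda>\<omega>'. indicator {\<theta>} (fst \<omega>')) \<omega>)"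

definition posterior_law ::
    "enat \<Rightarrow> real ^ 'n \<Rightarrow> (nat \<Rightarrow> 's topology) \<Rightarrow> ('n \<Rightarrow> (nat \<Rightarrow> 's) measure) \<Rightarrow> nat \<Rightarrow>
     (real ^ 'n) measure" where
  "posterior_law T \<mu> S \<pi> t = distr (joint_law T \<mu> S \<pi>) borel (posterior T \<mu> S \<pi> t)"

text \<open>The action sets are spaces with carriers inside one type \<open>'a\<close>; taking a disjoint union,
  this covers every family of action spaces. HOL cannot quantify over types inside a formula, so
  dominance in all AS problems is expressed with \<open>'a\<close> a type variable of the theorem,
  assumed infinite: a finite type may have too few actions (with one action per period all
  structures have the same value). A particular AS problem is covered by
  choosing \<open>'a\<close> large enough to contain its action sets.\<close>

definition AS_problem ::
    "enat \<Rightarrow> (nat \<Rightarrow> 'a topology) \<Rightarrow> (nat \<Rightarrow> 'a \<times> 'n \<Rightarrow> real) \<Rightarrow> bool" where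
  "AS_problem T A u \<longleftrightarrow>
     (\<forall>t\<in>periods T. topspace (A t) \<noteq> {} \<and> compact_space (A t) \<and>
        continuous_map (prod_topology (A t) (discrete_topology UNIV)) euclideanreal (u t)) \<and>
     (\<forall>a \<in> (\<Pi>\<^sub>E t\<in>periods T. topspace (A t)). \<forall>\<theta>. period_summable T (\<lambda>t. u t (a t, \<theta>)))"

text \<open>In an AS problem the supremum is attained, so it is the maximum.\<close>

definition period_value :: "'a topology \<Rightarrow> ('a \<times> 'n \<Rightarrow> real) \<Rightarrow> real ^ 'n \<Rightarrow> real" where
  "period_value A u x = (SUP a\<in>topspace A. \<Sum>\<theta>\<in>UNIV. x $ \<theta> * u (a, \<theta>))"

definition info_value ::
    "enat \<Rightarrow> real ^ 'n \<Rightarrow> (nat \<Rightarrow> 's topology) \<Rightarrow> ('n \<Rightarrow> (nat \<Rightarrow> 's) measure) \<Rightarrow>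
     (nat \<Rightarrow> 'a topology) \<Rightarrow> (nat \<Rightarrow> 'a \<times> 'n \<Rightarrow> real) \<Rightarrow> real" where
  "info_value T \<mu> S \<pi> A u =
     period_sum T (\<lambda>t. \<integral>x. period_value (A t) (u t) x \<partial>posterior_law T \<mu> S \<pi> t)"

text \<open>HOL cannot quantify existentially over the type of the common sample space. Fixing it to
  \<open>(real ^ 'n) \<times> (real ^ 'n)\<close> loses nothing: any pair \<open>(X, Y)\<close> can be replaced by the coordinate
  projections under its joint law.\<close>

definition mean_preserving_spread ::
    "(real ^ 'n) measure \<Rightarrow> (real ^ 'n) measure \<Rightarrow> bool" (infix "\<succeq>" 50) where
  "F \<succeq> G \<longleftrightarrow>
     (\<exists>(M :: ((real ^ 'n) \<times> (real ^ 'n)) measure) X Y.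
        prob_space M \<and> X \<in> borel_measurable M \<and> Y \<in> borel_measurable M \<and>
        distr M borel X = F \<and> distr M borel Y = G \<and>
        (\<forall>\<theta>. integrable M (\<lambda>\<omega>. X \<omega> $ \<theta>)) \<and>
        (AE \<omega> in M. \<forall>\<theta>. real_cond_exp M (vimage_algebra (space M) Y borel) (\<lambda>\<omega>'. X \<omega>' $ \<theta>) \<omega>
                         = Y \<omega> $ \<theta>))"

end

(* The value of period t depends on the structure only through F_t, since V_t is the support function
   of a bounded set of payoff vectors. If F_t is a mean-preserving spread of G_t, then conditional
   Jensen gives the inequality period by period; the sum over infinitely many periods converges
   because the oscillations of u_t are summable.

   Conversely, dominance applied to problems with a single active period and finitely many actions
   compares the integrals of all finite maxima of linear functions, and Strassen's theorem turns this
   into a martingale coupling. To prove Strassen's theorem, let Y have law G and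
   approximate it by simple functions r_k(Y).
   Up to an error 1/k, weights q_j(x) splitting F into pieces whose masses and first moments are those
   of G on the cells {r_k = j} exist: the achievable moment vectors form a convex set, and its support
   function dominates the target because it is the integral of a finite maximum. The resulting laws
   of (X, r_k(Y)) have a weak limit, which is the coupling. Weak compactness in R^n is pulled back
   along a space-filling curve to the Helly selection theorem on the line. *)
theory Submission imports Defs begin

text \<open>Strassen's theorem is usually derived by duality in a space of measures. Here only
  \<open>Y\<close> is discretised, so each stage concerns finitely many moment vectors in a
  finite-dimensional space. Since an error of 1/k is tolerated there, no closedness of the
  achievable set has to be shown: a near-minimiser of the distance to the target takes the place of
  a separating functional, and exactness appears only in the weak limit. Matching the masses yields
  the second marginal, matching the first moments the martingale property; both are tested by
  integrands affine in \<open>X\<close> and continuous in \<open>Y\<close>, which survive the limit.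
  On the simplex constants are linear functions, so values of decision problems provide enough
  tests.

  The curve transfers compactness because it has a Borel right inverse: laws travel to the line
  along the inverse, and the limit returns along the continuous curve.

  With infinitely many periods the values may converge only conditionally. The conditional part is
  the utility of an uninformed choice, which depends only on the mean posterior; the rest is
  absolutely summable.\<close>

section \<open>Weak compactness via a space-filling curve\<close>

text \<open>A clipped cosine in the role of the piecewise linear wave of Schoenberg's construction.
  Continuity and period 2 come from the cosine; the clipping at 0 and 1 makes it constant on
  [0, 1/3] and on [2/3, 1], since cos(pi/3) = 1/2 and cos(2 pi/3) = -1/2.\<close>

definition tooth :: "real \<Rightarrow> real" where
  "tooth t = min 1 (max 0 (1 / 2 - cos (pi * t)))"

lemma tooth_bounds: "0 \<le> tooth t" "tooth t \<le> 1"
  by (auto simp: tooth_def)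

lemma continuous_on_tooth [continuous_intros]:
  fixes f :: "'a::t2_space \<Rightarrow> real"
  shows "continuous_on S f \<Longrightarrow> continuous_on S (\<lambda>x. tooth (f x))"
  unfolding tooth_def by (intro continuous_intros)

lemma tooth_even_shift: "tooth (2 * of_int N + t) = tooth t"
proof -
  have "cos (pi * (2 * of_int N + t)) = cos (2 * pi * of_int N + pi * t)"
    by (simp add: algebra_simps)
  also have "\<dots> = cos (pi * t)"
    by (simp add: cos_add)
  finally show ?thesis
    by (simp add: tooth_def)
qed

lemma tooth_low: "tooth t = 0" if "0 \<le> t" "t \<le> 1 / 3"
proof -
  have "cos (pi / 3) \<le> cos (pi * t)"
    using that by (intro cos_monotone_0_pi_le) (auto simp: field_simps)
  then show ?thesis
    by (simp add: tooth_def cos_60)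
qed

lemma tooth_high: "tooth t = 1" if "2 / 3 \<le> t" "t \<le> 1"
proof -
  have "cos (pi * t) \<le> cos (2 * pi / 3)"
    using that by (intro cos_monotone_0_pi_le) (auto simp: field_simps)
  then show ?thesis
    by (simp add: tooth_def cos_120)
qed

section \<open>Ternary expansions with digits 0 and 2, and binary digits\<close>

lemma ternary_digits_summable:
  fixes a :: "nat \<Rightarrow> int"
  assumes "\<And>l. a l \<in> {0, 1}"
  shows "summable (\<lambda>l. 2 * real_of_int (a l) / 3 ^ Suc l)"
proof (rule summable_comparison_test')
  show "summable (\<lambda>l. (1 / 3 :: real) ^ l)"
    by (rule summable_geometric) simp
  show "norm (2 * real_of_int (a l) / 3 ^ Suc l) \<le> (1 / 3) ^ l" if "l \<ge> 0" for l
    using assms[of l] by (auto simp: field_simps)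
qed

lemma ternary_sum_bounds:
  fixes a :: "nat \<Rightarrow> int"
  assumes "\<And>l. a l \<in> {0, 1}"
  shows "(\<Sum>l. 2 * real_of_int (a l) / 3 ^ Suc l) \<in> {0..1}"
proof -
  have "(\<lambda>l. (2 / 3) * (1 / 3 :: real) ^ l) sums ((2 / 3) * (1 / (1 - 1 / 3)))"
    by (intro sums_mult geometric_sums) simp
  then have s: "(\<lambda>l. (2 / 3) * (1 / 3 :: real) ^ l) sums 1"
    by simp
  have "(\<Sum>l. 2 * real_of_int (a l) / 3 ^ Suc l) \<le> (\<Sum>l. (2 / 3) * (1 / 3 :: real) ^ l)"
  proof (rule suminf_le)
    show "2 * real_of_int (a l) / 3 ^ Suc l \<le> (2 / 3) * (1 / 3) ^ l" for l
      using assms[of l] by (auto simp: field_simps)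
  qed (use s ternary_digits_summable[OF assms] in \<open>auto simp: sums_iff\<close>)
  moreover have "0 \<le> (\<Sum>l. 2 * real_of_int (a l) / 3 ^ Suc l)"
  proof (rule suminf_nonneg[OF ternary_digits_summable[OF assms]])
    show "0 \<le> 2 * real_of_int (a l) / 3 ^ Suc l" for l
      using assms[of l] by auto
  qed
  ultimately show ?thesis
    using s by (simp add: sums_iff)
qed

text \<open>Multiplication by \<open>3 ^ m\<close> turns the first \<open>m\<close> digits into an
  integer, which is even because all digits are 0 or 2, so the period 2 erases it. The next digit
  places the remainder in [0, 1/3] or in [2/3, 1], where \<open>tooth\<close> is constant; the later
  digits therefore have no influence.\<close>

lemma tooth_ternary:
  fixes a :: "nat \<Rightarrow> int"
  assumes a: "\<And>l. a l \<in> {0, 1}"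
  shows "tooth (3 ^ m * (\<Sum>l. 2 * real_of_int (a l) / 3 ^ Suc l)) = of_int (a m)"
proof -
  let ?f = "\<lambda>l. 2 * real_of_int (a l) / 3 ^ Suc l"
  \<comment> \<open>The expansion formed by the digits after position \<open>m\<close>. The part of
    the product that survives the shift is \<open>2 * a m / 3 + z / 3\<close>.\<close>
  define z where "z = (\<Sum>l. 2 * real_of_int (a (l + Suc m)) / 3 ^ Suc l)"
  have "z \<in> {0..1}"
    unfolding z_def by (rule ternary_sum_bounds) (use a in auto)
  have "3 ^ m * (\<Sum>l. ?f l) = 3 ^ m * (\<Sum>l. ?f (l + Suc m)) + 3 ^ m * (\<Sum>l<Suc m. ?f l)"
    by (subst suminf_split_initial_segment[OF ternary_digits_summable[OF a], where k = "Suc m"])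
       (simp add: algebra_simps)
  also have "3 ^ m * (\<Sum>l. ?f (l + Suc m)) = z / 3"
  proof -
    have "summable (\<lambda>l. 2 * real_of_int (a (l + Suc m)) / 3 ^ Suc l)"
      by (rule ternary_digits_summable) (use a in auto)
    then have "(\<Sum>l. (1 / 3) * (2 * real_of_int (a (l + Suc m)) / 3 ^ Suc l)) = z / 3"
      unfolding z_def by (subst suminf_mult) auto
    moreover have "3 ^ m * (\<Sum>l. ?f (l + Suc m)) = (\<Sum>l. 3 ^ m * ?f (l + Suc m))"
      by (rule suminf_mult[symmetric])
         (use ternary_digits_summable[OF a] in \<open>rule summable_ignore_initial_segment\<close>)
    moreover have "3 ^ m * ?f (l + Suc m) = (1 / 3) * (2 * real_of_int (a (l + Suc m)) / 3 ^ Suc l)" for l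
      by (simp add: field_simps power_add)
    ultimately show ?thesis
      by simp
  qed
  also have "3 ^ m * (\<Sum>l<Suc m. ?f l)
             = 2 * of_int (\<Sum>l<m. a l * 3 ^ (m - Suc l)) + 2 * of_int (a m) / 3"
  proof -
    have "3 ^ m * ?f l = 2 * of_int (a l * 3 ^ (m - Suc l))" if "l < m" for l
    proof -
      have "(3 :: real) ^ m = 3 ^ (m - Suc l) * 3 ^ Suc l"
        using that by (subst power_add[symmetric]) simp
      then show ?thesis
        by simp
    qed
    then have "3 ^ m * (\<Sum>l<m. ?f l) = 2 * of_int (\<Sum>l<m. a l * 3 ^ (m - Suc l))"
      by (simp add: sum_distrib_left del: power_Suc)
    then show ?thesis
      by (simp add: algebra_simps)
  qed
  finally have "tooth (3 ^ m * (\<Sum>l. ?f l))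
      = tooth (2 * of_int (\<Sum>l<m. a l * 3 ^ (m - Suc l)) + (2 * of_int (a m) / 3 + z / 3))"
    by (simp add: algebra_simps)
  also have "\<dots> = tooth (2 * of_int (a m) / 3 + z / 3)"
    by (rule tooth_even_shift)
  also have "\<dots> = of_int (a m)"
    using a[of m] \<open>z \<in> {0..1}\<close> by (auto intro!: tooth_low tooth_high)
  finally show ?thesis .
qed

text \<open>The digit of weight 1 / \<open>2 ^ Suc k\<close>. The formula by floors makes
  measurability in \<open>x\<close> immediate.\<close>

definition binary_digit :: "real \<Rightarrow> nat \<Rightarrow> int" where
  "binary_digit x k = \<lfloor>2 ^ Suc k * x\<rfloor> - 2 * \<lfloor>2 ^ k * x\<rfloor>"

lemma binary_digit_cases: "binary_digit x k \<in> {0, 1}"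
proof -
  have "2 * \<lfloor>2 ^ k * x\<rfloor> \<le> \<lfloor>2 * (2 ^ k * x)\<rfloor>"
    by (simp add: le_floor_iff)
  moreover have "\<lfloor>2 * (2 ^ k * x)\<rfloor> < 2 * \<lfloor>2 ^ k * x\<rfloor> + 2"
    unfolding floor_less_iff by simp linarith
  ultimately show ?thesis
    by (auto simp: binary_digit_def mult.assoc)
qed

text \<open>The sum telescopes: its first \<open>n\<close> terms give \<open>x\<close> rounded down
  to a multiple of 1 / \<open>2 ^ n\<close>. The starting value is the floor of \<open>x\<close>,
  which vanishes for \<open>x\<close> in [0, 1).\<close>

lemma binary_digits_sums:
  assumes "0 \<le> x" "x < 1"
  shows "(\<lambda>k. real_of_int (binary_digit x k) / 2 ^ Suc k) sums x"
proof -
  have partial: "(\<Sum>k<n. real_of_int (binary_digit x k) / 2 ^ Suc k) = of_int \<lfloor>2 ^ n * x\<rfloor> / 2 ^ n" for n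
  proof (induction n)
    case 0
    then show ?case
      using assms by (simp add: floor_eq_iff)
  next
    case (Suc n)
    then show ?case
      by (simp add: binary_digit_def field_simps)
  qed
  have "(\<lambda>n. of_int \<lfloor>2 ^ n * x\<rfloor> / 2 ^ n) \<longlonglongrightarrow> x"
  proof (rule real_tendsto_sandwich[where f = "\<lambda>n. x - (1 / 2) ^ n" and h = "\<lambda>n. x"])
    have "(\<lambda>n. x - (1 / 2) ^ n) \<longlonglongrightarrow> x - 0"
      by (intro tendsto_intros LIMSEQ_power_zero) simp
    then show "(\<lambda>n. x - (1 / 2) ^ n) \<longlonglongrightarrow> x"
      by simp
    have "x - (1 / 2) ^ n \<le> of_int \<lfloor>2 ^ n * x\<rfloor> / 2 ^ n" for n
    proof -
      have "2 ^ n * x - 1 \<le> of_int \<lfloor>2 ^ n * x\<rfloor>"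
        by linarith
      then have "(2 ^ n * x - 1) / 2 ^ n \<le> of_int \<lfloor>2 ^ n * x\<rfloor> / 2 ^ n"
        by (intro divide_right_mono) auto
      then show ?thesis
        by (simp add: diff_divide_distrib power_one_over)
    qed
    then show "\<forall>\<^sub>F n in sequentially. x - (1 / 2) ^ n \<le> of_int \<lfloor>2 ^ n * x\<rfloor> / 2 ^ n"
      by simp
    have "of_int \<lfloor>2 ^ n * x\<rfloor> / 2 ^ n \<le> x" for n
      using of_int_floor_le[of "2 ^ n * x"] by (simp add: field_simps)
    then show "\<forall>\<^sub>F n in sequentially. of_int \<lfloor>2 ^ n * x\<rfloor> / 2 ^ n \<le> x"
      by simp
  qed simp
  then show ?thesis
    unfolding sums_def partial .
qed

text \<open>Schoenberg's space-filling curve. The value of the \<open>i\<close>-th coordinate at \<open>t\<close> is read off the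
  ternary digits of \<open>t\<close> at the positions \<open>prod_encode (i, k)\<close>.\<close>

definition schoenberg :: "nat \<Rightarrow> real \<Rightarrow> real" where
  "schoenberg i t = (\<Sum>k. tooth (3 ^ prod_encode (i, k) * t) / 2 ^ Suc k)"

text \<open>The pairing function interleaves the binary digits of all coordinates into one ternary
  expansion. Doubling them gives a point of the Cantor set, the kind of point at which
  \<open>tooth_ternary\<close> reads digits.\<close>

definition schoenberg_preimage :: "(nat \<Rightarrow> real) \<Rightarrow> real" where
  "schoenberg_preimage x =
     (\<Sum>l. 2 * real_of_int (case prod_decode l of (i, k) \<Rightarrow> binary_digit (x i) k) / 3 ^ Suc l)"

lemma schoenberg_term_le: "norm (tooth t / 2 ^ Suc k) \<le> (1 / 2) ^ Suc k"
  using tooth_bounds[of t] by (simp add: field_simps)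

lemma schoenberg_bounds: "\<bar>schoenberg i t\<bar> \<le> 1"
proof -
  have "norm (\<Sum>k. tooth (3 ^ prod_encode (i, k) * t) / 2 ^ Suc k) \<le> (\<Sum>k. (1 / 2) ^ Suc k)"
    by (rule norm_suminf_le[OF schoenberg_term_le]) (use power_half_series in \<open>simp add: sums_iff\<close>)
  then show ?thesis
    using power_half_series by (simp add: schoenberg_def sums_iff)
qed

lemma continuous_on_schoenberg: "continuous_on UNIV (schoenberg i)"
proof -
  have "uniform_limit UNIV (\<lambda>n t. \<Sum>k<n. tooth (3 ^ prod_encode (i, k) * t) / 2 ^ Suc k)
          (\<lambda>t. \<Sum>k. tooth (3 ^ prod_encode (i, k) * t) / 2 ^ Suc k) sequentially"
    by (rule Weierstrass_m_test[OF schoenberg_term_le])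
       (use power_half_series in \<open>simp add: sums_iff\<close>)
  then have "uniform_limit UNIV (\<lambda>n t. \<Sum>k<n. tooth (3 ^ prod_encode (i, k) * t) / 2 ^ Suc k)
          (schoenberg i) sequentially"
    by (simp add: schoenberg_def[abs_def])
  then show ?thesis
    by (rule uniform_limit_theorem[rotated]) (auto intro!: always_eventually continuous_intros)
qed

lemma schoenberg_preimage_bounds: "schoenberg_preimage x \<in> {0..1}"
  unfolding schoenberg_preimage_def
  by (rule ternary_sum_bounds) (use binary_digit_cases in \<open>auto split: prod.split\<close>)

lemma schoenberg_right_inverse:
  assumes "0 \<le> x i" "x i < 1"
  shows "schoenberg i (schoenberg_preimage x) = x i"
proof -
  have "tooth (3 ^ prod_encode (i, k) * schoenberg_preimage x) = of_int (binary_digit (x i) k)" for k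
    unfolding schoenberg_preimage_def
    by (subst tooth_ternary) (use binary_digit_cases in \<open>auto split: prod.split\<close>)
  then show ?thesis
    using binary_digits_sums[OF assms] by (simp add: schoenberg_def sums_iff)
qed

text \<open>For a law on the ball of radius \<open>R\<close>, pushing forward by \<open>h\<close>
  and then by \<open>g\<close> changes nothing. Continuity is asked of \<open>g\<close> only,
  because test functions are composed with \<open>g\<close>; for \<open>h\<close> measurability
  suffices to move laws to the line.\<close>

lemma curve_with_measurable_right_inverse:
  fixes R :: real
  assumes "0 \<le> R"
  obtains g :: "real \<Rightarrow> 'a::euclidean_space" and h :: "'a \<Rightarrow> real"
  where "continuous_on UNIV g" "bounded (range g)" "h \<in> borel_measurable borel"
    "\<And>x. h x \<in> {0..1}" "\<And>x. norm x \<le> R \<Longrightarrow> g (h x) = x"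
proof -
  obtain e :: "'a \<Rightarrow> nat" where e: "inj_on e Basis"
    using finite_imp_inj_to_nat_seg[OF finite_Basis] by metis
  define g :: "real \<Rightarrow> 'a" where
    "g t = (\<Sum>b\<in>Basis. ((2 * R + 1) * schoenberg (e b) t - R) *\<^sub>R b)" for t
  \<comment> \<open>The scale \<open>2 * R + 1\<close> instead of \<open>2 * R\<close> maps [-R, R]
    into [0, 1) with 1 excluded, as \<open>schoenberg_right_inverse\<close> requires, and avoids
    division by zero for \<open>R = 0\<close>.\<close>
  define x' :: "'a \<Rightarrow> nat \<Rightarrow> real" where
    "x' x i = (x \<bullet> inv_into Basis e i + R) / (2 * R + 1)" for x i
  define h where "h x = schoenberg_preimage (x' x)" for x
  show thesis
  proof
    show "continuous_on UNIV g"
      unfolding g_def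
      by (intro continuous_intros continuous_on_schoenberg)
    show "bounded (range g)"
    proof (rule boundedI)
      fix y assume "y \<in> range g"
      then obtain t where t: "y = g t"
        by auto
      have "norm (g t) \<le> (\<Sum>b\<in>(Basis::'a set). (2 * R + 1) + R)"
        unfolding g_def
      proof (rule sum_norm_le)
        fix b :: 'a assume "b \<in> Basis"
        have "\<bar>(2 * R + 1) * schoenberg (e b) t - R\<bar> \<le> \<bar>(2 * R + 1) * schoenberg (e b) t\<bar> + R"
          using assms by linarith
        also have "\<dots> \<le> (2 * R + 1) * 1 + R"
          unfolding abs_mult using assms schoenberg_bounds
          by (intro add_right_mono mult_mono) auto
        finally show "norm (((2 * R + 1) * schoenberg (e b) t - R) *\<^sub>R b) \<le> (2 * R + 1) + R"
          using \<open>b \<in> Basis\<close> by simp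
      qed
      then show "norm y \<le> (\<Sum>b\<in>(Basis::'a set). (2 * R + 1) + R)"
        using t by simp
    qed
    have [measurable]: "(\<lambda>x. binary_digit (x' x i) k) \<in> measurable borel (count_space UNIV)" for i k
      unfolding binary_digit_def x'_def by measurable
    show "h \<in> borel_measurable borel"
      unfolding h_def schoenberg_preimage_def case_prod_beta by measurable
    show "h x \<in> {0..1}" for x
      unfolding h_def by (rule schoenberg_preimage_bounds)
    show "g (h x) = x" if "norm x \<le> R" for x
    proof -
      have "(2 * R + 1) * schoenberg (e b) (h x) - R = x \<bullet> b" if b: "b \<in> Basis" for b
      proof -
        have "\<bar>x \<bullet> b\<bar> \<le> R"
          using Basis_le_norm[OF b, of x] \<open>norm x \<le> R\<close> by linarith
        then have "0 \<le> x' x (e b)" "x' x (e b) < 1"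
          using b e assms by (auto simp: x'_def field_simps)
        then have "schoenberg (e b) (h x) = x' x (e b)"
          unfolding h_def by (rule schoenberg_right_inverse)
        then show ?thesis
          using b e assms by (simp add: x'_def)
      qed
      then show ?thesis
        unfolding g_def by (simp add: euclidean_representation)
    qed
  qed
qed

proposition bounded_support_imp_weakly_convergent_subsequence:
  fixes M :: "nat \<Rightarrow> 'a::euclidean_space measure"
  assumes prob: "\<And>n. prob_space (M n)" and sets: "\<And>n. sets (M n) = sets borel"
    and bdd: "\<And>n. AE x in M n. norm x \<le> R"
  obtains s :: "nat \<Rightarrow> nat" and N :: "'a measure"
  where "strict_mono s" "prob_space N" "sets N = sets borel"
    "\<And>f. continuous_on UNIV f \<Longrightarrow> (\<lambda>n. \<integral>x. f x \<partial>M (s n)) \<longlonglongrightarrow> (\<integral>x. (f x :: real) \<partial>N)"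
proof -
  obtain g :: "real \<Rightarrow> 'a" and h :: "'a \<Rightarrow> real"
    where g: "continuous_on UNIV g" "bounded (range g)" and h: "h \<in> borel_measurable borel"
      "\<And>x. h x \<in> {0..1}" and gh: "\<And>x. norm x \<le> max 0 R \<Longrightarrow> g (h x) = x"
    \<comment> \<open>The maximum supplies the nonnegative radius without first deducing the sign of
      \<open>R\<close> from the support condition.\<close>
    using curve_with_measurable_right_inverse[of "max 0 R"] by auto
  have [measurable]: "g \<in> borel_measurable borel"
    using g(1) by (rule borel_measurable_continuous_onI)
  note h(1)[measurable] sets[measurable_cong]
  define L where "L n = distr (M n) borel h" for n
  have L: "real_distribution (L n)" for n
    unfolding L_def real_distribution_def real_distribution_axioms_def
    by (auto intro!: prob_space.prob_space_distr prob)
  have "tight L"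
    unfolding tight_def
  proof (intro conjI allI impI L)
    fix \<epsilon> :: real assume "0 < \<epsilon>"
    \<comment> \<open>Tightness is phrased with intervals open on the left, and \<open>h\<close> may
      take the value 0; hence the left endpoint -1.\<close>
    have "measure (L n) {-1<..1} = 1" for n
    proof -
      have "h x \<in> {-1<..1}" for x
        using h(2)[of x] by simp
      then have *: "h -` {-1<..1} \<inter> space (M n) = space (M n)"
        by blast
      have "measure (L n) {-1<..1} = measure (M n) (space (M n))"
        unfolding L_def by (subst measure_distr) (simp_all add: *)
      then show ?thesis
        using prob_space.prob_space[OF prob] by simp
    qed
    then show "\<exists>a b. a < b \<and> (\<forall>n. 1 - \<epsilon> < measure (L n) {a<..b})"
      using \<open>0 < \<epsilon>\<close> by (intro exI[of _ "-1"] exI[of _ 1]) simp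
  qed
  then obtain s K where s: "strict_mono s" and K: "real_distribution K"
    and "weak_conv_m (L \<circ> id \<circ> s) K"
    using tight_imp_convergent_subsubsequence[of L id] by (auto simp: strict_mono_def)
  then have conv: "weak_conv_m (\<lambda>n. L (s n)) K"
    by (simp add: o_def)
  interpret K: real_distribution K
    by (fact K)
  define N where "N = distr K borel g"
  show thesis
  proof
    show "strict_mono s" by (fact s)
    show "prob_space N"
      unfolding N_def by (rule K.prob_space_distr) simp
    show "sets N = sets borel"
      by (simp add: N_def)
    fix f :: "'a \<Rightarrow> real" assume f: "continuous_on UNIV f"
    have [measurable]: "f \<in> borel_measurable borel"
      using f by (rule borel_measurable_continuous_onI)
    have fg: "continuous_on UNIV (\<lambda>t. f (g t))"
      by (rule continuous_on_compose2[OF f g(1)]) simp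
    \<comment> \<open>Convergence of integrals on the line is available for bounded continuous
      functions; compactness of this image bounds \<open>f\<close> composed with
      \<open>g\<close>.\<close>
    have "compact (f ` closure (range g))"
      using g(2) f by (intro compact_continuous_image continuous_on_subset[OF f]) auto
    then have "bounded (f ` closure (range g))"
      by (rule compact_imp_bounded)
    then obtain B where B: "\<forall>y\<in>f ` closure (range g). norm y \<le> B"
      unfolding bounded_iff by auto
    have f_bound: "norm (f (g t)) \<le> B" for t
    proof -
      have "g t \<in> closure (range g)"
        by (rule subsetD[OF closure_subset]) simp
      then show ?thesis
        using B by simp
    qed
    have "(\<lambda>n. \<integral>t. f (g t) \<partial>L (s n)) \<longlonglongrightarrow> (\<integral>t. f (g t) \<partial>K)"
    proof (rule weak_conv_imp_integral_bdd_continuous_conv[OF _ K conv])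
      show "isCont (\<lambda>t. f (g t)) x" for x
        using fg continuous_on_eq_continuous_at[OF open_UNIV] by blast
      show "norm (f (g x)) \<le> B" for x
        by (rule f_bound)
    qed (rule L)
    also have "(\<integral>t. f (g t) \<partial>K) = (\<integral>x. f x \<partial>N)"
      unfolding N_def by (subst integral_distr) simp_all
    also have "(\<lambda>n. \<integral>t. f (g t) \<partial>L (s n)) = (\<lambda>n. \<integral>x. f x \<partial>M (s n))"
    proof
      fix n
      have "(\<integral>t. f (g t) \<partial>L (s n)) = (\<integral>x. f (g (h x)) \<partial>M (s n))"
        unfolding L_def by (subst integral_distr) simp_all
      also have "\<dots> = (\<integral>x. f x \<partial>M (s n))"
        using bdd[of "s n"] by (intro integral_cong_AE) (auto simp: gh elim!: eventually_mono)
      finally show "(\<integral>t. f (g t) \<partial>L (s n)) = (\<integral>x. f x \<partial>M (s n))" .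
    qed
    finally show "(\<lambda>n. \<integral>x. f x \<partial>M (s n)) \<longlonglongrightarrow> (\<integral>x. f x \<partial>N)" .
  qed
qed

section \<open>Martingale couplings of measures in convex order\<close>

text \<open>Closed sets form an intersection-stable generator of the Borel sets, and the indicator
  of a closed set is the pointwise limit of continuous functions decreasing with the distance to it.
  This upgrades identities obtained from weak limits to equality of measures.\<close>

lemma measure_eqI_continuous:
  fixes M N :: "'a::metric_space measure"
  assumes "finite_measure M" "finite_measure N"
    and sets: "sets M = sets borel" "sets N = sets borel"
    and eq: "\<And>f :: 'a \<Rightarrow> real. continuous_on UNIV f \<Longrightarrow> (\<And>x. f x \<in> {0..1}) \<Longrightarrow>
               (\<integral>x. f x \<partial>M) = (\<integral>x. f x \<partial>N)"
  shows "M = N"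
proof (rule measure_eqI_generator_eq[where E = "Collect closed" and \<Omega> = UNIV and A = "\<lambda>_. UNIV"])
  interpret M: finite_measure M by fact
  interpret N: finite_measure N by fact
  note sets[measurable_cong]
  show "Int_stable (Collect closed :: 'a set set)"
    by (auto simp: Int_stable_def)
  show "sets M = sigma_sets UNIV (Collect closed)" "sets N = sigma_sets UNIV (Collect closed)"
    using sets by (simp_all add: borel_eq_closed)
  show "emeasure M UNIV \<noteq> \<infinity>"
    by (simp add: M.emeasure_eq_measure)
  fix C :: "'a set" assume "C \<in> Collect closed"
  then have C: "closed C" by simp
  show "emeasure M C = emeasure N C"
  \<comment> \<open>The empty set is separate because \<open>infdist\<close> to it is 0 by
    convention, so the functions \<open>f k\<close> would be constantly 1.\<close>
  proof (cases "C = {}")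
    case False
    define f :: "nat \<Rightarrow> 'a \<Rightarrow> real" where "f k x = max 0 (1 - real k * infdist x C)" for k x
    have f_cont: "continuous_on UNIV (f k)" for k
      unfolding f_def by (intro continuous_intros)
    have f_bounds: "f k x \<in> {0..1}" for k x
      by (auto simp: f_def infdist_nonneg)
    have f_lim: "(\<lambda>k. f k x) \<longlonglongrightarrow> indicator C x" for x
    proof (cases "x \<in> C")
      case True
      then show ?thesis
        by (simp add: f_def infdist_zero)
    next
      case x: False
      then have "infdist x C \<noteq> 0"
        using in_closed_iff_infdist_zero[OF C False] by blast
      then have pos: "infdist x C > 0"
        using infdist_nonneg[of x C] by linarith
      then obtain k0 where k0: "1 < real k0 * infdist x C"
        using ex_less_of_nat_mult[of "infdist x C" 1] by auto
      have "f k x = 0" if "k0 \<le> k" for k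
      proof -
        have "real k0 * infdist x C \<le> real k * infdist x C"
          using that pos by (intro mult_right_mono) auto
        then show ?thesis
          using k0 by (simp add: f_def)
      qed
      then have "\<forall>\<^sub>F k in sequentially. f k x = indicator C x"
        using x by (auto simp: eventually_sequentially)
      then show ?thesis
        by (rule tendsto_eventually)
    qed
    have lim: "(\<lambda>k. \<integral>x. f k x \<partial>K) \<longlonglongrightarrow> (\<integral>x. indicator C x \<partial>K)"
      if "finite_measure K" "sets K = sets borel" for K
    proof (rule integral_dominated_convergence[where w = "\<lambda>_. 1"])
      interpret K: finite_measure K by fact
      note that(2)[measurable_cong]
      have [measurable]: "C \<in> sets borel"
        using C by (rule borel_closed)
      show "(\<lambda>x. indicator C x :: real) \<in> borel_measurable K"
        by measurable
      show "f k \<in> borel_measurable K" for k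
        using borel_measurable_continuous_onI[OF f_cont] that(2) by (simp cong: measurable_cong_sets)
      show "AE x in K. norm (f k x) \<le> 1" for k
        using f_bounds[of k] by (intro AE_I2) (simp add: abs_le_iff order_trans[of "-1" 0])
    qed (use that f_lim in \<open>auto simp: finite_measure.integrable_const\<close>)
    have "(\<lambda>k. \<integral>x. f k x \<partial>N) \<longlonglongrightarrow> (\<integral>x. indicator C x \<partial>M)"
      using lim[OF assms(1) sets(1)] eq[OF f_cont f_bounds] by simp
    then have "(\<integral>x. indicator C x \<partial>M) = (\<integral>x. indicator C x \<partial>N :: real)"
      using lim[OF assms(2) sets(2)] by (rule LIMSEQ_unique)
    then show ?thesis
      using sets[THEN sets_eq_imp_space_eq]
      by (simp add: M.emeasure_eq_measure N.emeasure_eq_measure)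
  qed simp
qed auto

section \<open>Approximation of finitely many moments by splitting a measure\<close>

text \<open>A near-minimiser \<open>c\<close> of the distance to \<open>v\<close> cannot be moved closer in any direction \<open>c' - c\<close>;
  for the \<open>c'\<close> that supports \<open>C\<close> in the direction \<open>v - c\<close> this bounds the distance.\<close>

lemma convex_family_approximates:
  fixes C :: "('j \<Rightarrow> 'b::real_inner) set" and \<epsilon> R :: real
  assumes J: "finite J"
    and convex: "\<And>c c' s. c \<in> C \<Longrightarrow> c' \<in> C \<Longrightarrow> 0 \<le> s \<Longrightarrow> s \<le> 1 \<Longrightarrow>
                   (\<lambda>j. (1 - s) *\<^sub>R c j + s *\<^sub>R c' j) \<in> C"
    and bounded: "\<And>c j. c \<in> C \<Longrightarrow> j \<in> J \<Longrightarrow> norm (c j) \<le> R"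
    and support: "\<And>w. \<exists>c\<in>C. (\<Sum>j\<in>J. w j \<bullet> v j) \<le> (\<Sum>j\<in>J. w j \<bullet> c j)"
    and "0 < \<epsilon>"
  obtains c where "c \<in> C" "(\<Sum>j\<in>J. (norm (c j - v j))\<^sup>2) < \<epsilon>"
proof -
  define D where "D c = (\<Sum>j\<in>J. (norm (c j - v j))\<^sup>2)" for c
  define K where "K = (\<Sum>j\<in>J. (2 * R)\<^sup>2)"
  \<comment> \<open>Both the tolerance \<open>s * \<epsilon>\<close> in the choice of
    \<open>c\<close> and the quadratic term, at most \<open>s\<^sup>2 * K\<close>, carry a factor
    \<open>s\<close>. After division by \<open>s\<close> there remains
    \<open>2 * D c < \<epsilon> + s * K\<close>, and this \<open>s\<close> makes
    \<open>s * K\<close> less than \<open>\<epsilon>\<close>.\<close>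
  define s where "s = min 1 (\<epsilon> / (K + 1))"
  have "0 \<le> K"
    unfolding K_def by (intro sum_nonneg) auto
  have s: "0 < s" "s \<le> 1"
    using \<open>0 < \<epsilon>\<close> \<open>0 \<le> K\<close> by (auto simp: s_def)
  have sK: "s * K < \<epsilon>"
  proof -
    have "s * K \<le> \<epsilon> / (K + 1) * K"
      using \<open>0 \<le> K\<close> by (intro mult_right_mono) (auto simp: s_def)
    also have "\<dots> < \<epsilon>"
      using \<open>0 < \<epsilon>\<close> \<open>0 \<le> K\<close> by (simp add: field_simps)
    finally show ?thesis .
  qed
  have "C \<noteq> {}"
    using support by blast
  have D_nonneg: "0 \<le> D c" for c
    unfolding D_def by (intro sum_nonneg) auto
  then have bdd: "bdd_below (D ` C)"
    by (intro bdd_belowI[of _ 0]) auto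
  have "(INF c\<in>C. D c) < (INF c\<in>C. D c) + s * \<epsilon>"
    using s \<open>0 < \<epsilon>\<close> by simp
  then obtain c where c: "c \<in> C" "D c < (INF c\<in>C. D c) + s * \<epsilon>"
    using cINF_less_iff[OF \<open>C \<noteq> {}\<close> bdd] by blast
  obtain c' where c': "c' \<in> C" "(\<Sum>j\<in>J. (v j - c j) \<bullet> v j) \<le> (\<Sum>j\<in>J. (v j - c j) \<bullet> c' j)"
    using support[of "\<lambda>j. v j - c j"] by blast
  define d where "d j = c' j - c j" for j
  have "(\<lambda>j. (1 - s) *\<^sub>R c j + s *\<^sub>R c' j) = (\<lambda>j. c j + s *\<^sub>R d j)"
    by (auto simp: d_def algebra_simps)
  moreover have "(\<lambda>j. (1 - s) *\<^sub>R c j + s *\<^sub>R c' j) \<in> C"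
    by (rule convex[OF c(1) c'(1)]) (use s in auto)
  ultimately have "(\<lambda>j. c j + s *\<^sub>R d j) \<in> C"
    by (simp only:)
  then have "(INF c\<in>C. D c) \<le> D (\<lambda>j. c j + s *\<^sub>R d j)"
    by (intro cINF_lower bdd)
  also have "\<dots> = D c + 2 * s * (\<Sum>j\<in>J. (c j - v j) \<bullet> d j) + s\<^sup>2 * (\<Sum>j\<in>J. (norm (d j))\<^sup>2)"
  proof -
    have expand: "(norm (a + s *\<^sub>R e))\<^sup>2 = (norm a)\<^sup>2 + 2 * s * (a \<bullet> e) + s\<^sup>2 * (norm e)\<^sup>2" for a e :: 'b
      unfolding power2_norm_eq_inner
      by (simp add: inner_add_left inner_add_right inner_commute power2_eq_square algebra_simps)
    have "(norm (c j + s *\<^sub>R d j - v j))\<^sup>2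
        = (norm (c j - v j))\<^sup>2 + 2 * s * ((c j - v j) \<bullet> d j) + s\<^sup>2 * (norm (d j))\<^sup>2" for j
      using expand[of "c j - v j" "d j"] by (simp only: diff_add_eq)
    then show ?thesis
      by (simp add: D_def sum_distrib_left sum.distrib)
  qed
  finally have le: "(INF c\<in>C. D c)
      \<le> D c + 2 * s * (\<Sum>j\<in>J. (c j - v j) \<bullet> d j) + s\<^sup>2 * (\<Sum>j\<in>J. (norm (d j))\<^sup>2)" .
  \<comment> \<open>The support property of \<open>c'\<close> makes the right side nonpositive, so
    the squared distance has slope at most \<open>-2 * D c\<close> from \<open>c\<close> towards
    \<open>c'\<close>.\<close>
  have "(\<Sum>j\<in>J. (c j - v j) \<bullet> d j) + D c = (\<Sum>j\<in>J. (v j - c j) \<bullet> v j) - (\<Sum>j\<in>J. (v j - c j) \<bullet> c' j)"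
    unfolding D_def d_def sum.distrib[symmetric] sum_subtractf[symmetric]
  proof (intro sum.cong refl)
    fix j
    have "c j - v j = - (v j - c j)" "c' j - c j = (c' j - v j) + (v j - c j)"
      by simp_all
    then show "(c j - v j) \<bullet> (c' j - c j) + (norm (c j - v j))\<^sup>2
        = (v j - c j) \<bullet> v j - (v j - c j) \<bullet> c' j"
      by (simp only: power2_norm_eq_inner inner_minus_left inner_minus_right inner_add_right)
         (simp add: inner_diff_right)
  qed
  then have inner_le: "(\<Sum>j\<in>J. (c j - v j) \<bullet> d j) \<le> - D c"
    using c'(2) by linarith
  have d_le: "(\<Sum>j\<in>J. (norm (d j))\<^sup>2) \<le> K"
    unfolding K_def
  proof (intro sum_mono power_mono)
    show "norm (d j) \<le> 2 * R" if "j \<in> J" for j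
      using norm_triangle_ineq4[of "c' j" "c j"] bounded[OF c(1) that] bounded[OF c'(1) that]
      unfolding d_def by linarith
  qed auto
  have "s * (2 * (\<Sum>j\<in>J. (c j - v j) \<bullet> d j)) \<le> s * (2 * - D c)"
    using inner_le s by (intro mult_left_mono) auto
  moreover have "s\<^sup>2 * (\<Sum>j\<in>J. (norm (d j))\<^sup>2) \<le> s\<^sup>2 * K"
    using d_le by (intro mult_left_mono) auto
  ultimately have "s * (2 * D c) < s * \<epsilon> + s\<^sup>2 * K"
    using le c(2) by (simp add: algebra_simps)
  also have "\<dots> = s * (\<epsilon> + s * K)"
    by (simp add: power2_eq_square algebra_simps)
  finally have "2 * D c < \<epsilon> + s * K"
    using s(1) by (simp only: mult_less_cancel_left_pos)
  then have "D c < \<epsilon>"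
    using sK by linarith
  then show thesis
    using that[OF c(1)] by (simp add: D_def)
qed

text \<open>A Markov kernel into the finite set \<open>J\<close>: \<open>q j x\<close> is the share
  of the mass at \<open>x\<close> sent to \<open>j\<close>. Nothing is required of indices outside
  \<open>J\<close>.\<close>

definition stochastic_weights :: "'j set \<Rightarrow> ('j \<Rightarrow> 'a::euclidean_space \<Rightarrow> real) \<Rightarrow> bool" where
  "stochastic_weights J q \<longleftrightarrow>
     (\<forall>j\<in>J. q j \<in> borel_measurable borel) \<and> (\<forall>j\<in>J. \<forall>x. 0 \<le> q j x) \<and> (\<forall>x. (\<Sum>j\<in>J. q j x) = 1)"

lemma stochastic_weights_le_1:
  assumes "stochastic_weights J q" "finite J" "j \<in> J"
  shows "q j x \<le> 1"
  using member_le_sum[of j J "\<lambda>j. q j x"] assms by (auto simp: stochastic_weights_def)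

text \<open>Ties are shared equally among the maximisers, counted by \<open>n\<close>. This avoids a
  selection and keeps the weights measurable.\<close>

lemma argmax_weights:
  fixes \<phi> :: "'j \<Rightarrow> 'a::euclidean_space \<Rightarrow> real"
  assumes J: "finite J" "J \<noteq> {}" and \<phi>: "\<And>j. j \<in> J \<Longrightarrow> \<phi> j \<in> borel_measurable borel"
  obtains q where "stochastic_weights J q"
    "\<And>x. (\<Sum>j\<in>J. q j x * \<phi> j x) = Max ((\<lambda>j. \<phi> j x) ` J)"
proof
  define A where "A j = {x. \<forall>i\<in>J. \<phi> i x \<le> \<phi> j x}" for j
  define n :: "'a \<Rightarrow> real" where "n x = (\<Sum>i\<in>J. indicator (A i) x)" for x
  define q where "q j x = indicator (A j) x / n x" for j x
  have \<phi>_eq: "\<phi> j x = Max ((\<lambda>j. \<phi> j x) ` J)" if "x \<in> A j" "j \<in> J" for j x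
    using that J by (intro Max_eqI[symmetric]) (auto simp: A_def)
  have n_pos: "0 < n x" for x
  proof -
    have "Max ((\<lambda>j. \<phi> j x) ` J) \<in> (\<lambda>j. \<phi> j x) ` J"
      using J by (intro Max_in) auto
    then obtain j where "j \<in> J" "\<phi> j x = Max ((\<lambda>j. \<phi> j x) ` J)"
      by auto
    then have "x \<in> A j" "j \<in> J"
      using J by (auto simp: A_def)
    then show ?thesis
      unfolding n_def using J by (intro sum_pos2[of _ j]) auto
  qed
  have [measurable]: "A j \<in> sets borel" if "j \<in> J" for j
  proof -
    have "A j = (\<Inter>i\<in>J. {x. \<phi> i x \<le> \<phi> j x})"
      by (auto simp: A_def)
    also have "\<dots> \<in> sets borel"
      using J \<phi> that by (intro sets.finite_INT) (auto intro!: borel_measurable_le)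
    finally show ?thesis .
  qed
  have sum_q: "(\<Sum>j\<in>J. q j x) = 1" for x
    using n_pos[of x] by (simp add: q_def sum_divide_distrib[symmetric] n_def)
  show "stochastic_weights J q"
    unfolding stochastic_weights_def
  proof (intro conjI ballI allI)
    show "q j \<in> borel_measurable borel" if "j \<in> J" for j
    proof -
      have "n \<in> borel_measurable borel"
        unfolding n_def by (intro borel_measurable_sum borel_measurable_indicator) simp
      then show ?thesis
        unfolding q_def using that by measurable
    qed
    show "0 \<le> q j x" for j x
      using n_pos[of x] by (simp add: q_def)
  qed (rule sum_q)
  show "(\<Sum>j\<in>J. q j x * \<phi> j x) = Max ((\<lambda>j. \<phi> j x) ` J)" for x
  proof -
    have "(\<Sum>j\<in>J. q j x * \<phi> j x) = (\<Sum>j\<in>J. q j x * Max ((\<lambda>j. \<phi> j x) ` J))"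
    proof (intro sum.cong refl)
      fix j assume "j \<in> J"
      then show "q j x * \<phi> j x = q j x * Max ((\<lambda>j. \<phi> j x) ` J)"
        using \<phi>_eq[of x j] by (cases "x \<in> A j") (auto simp: q_def)
    qed
    also have "\<dots> = Max ((\<lambda>j. \<phi> j x) ` J)"
      by (simp add: sum_distrib_right[symmetric] sum_q)
    finally show ?thesis .
  qed
qed

text \<open>Affine functions of \<open>x\<close> are linear functions of \<open>lift x\<close>.\<close>

definition lift :: "'a \<Rightarrow> real \<times> 'a" where
  "lift x = (1, x)"

lemma continuous_on_lift [continuous_intros]:
  "continuous_on S f \<Longrightarrow> continuous_on S (\<lambda>x. lift (f x))"
  unfolding lift_def by (intro continuous_intros)

lemma measurable_lift [measurable]:
  "(lift :: 'a::euclidean_space \<Rightarrow> _) \<in> borel_measurable borel"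
  by (intro borel_measurable_continuous_onI continuous_intros)

lemma norm_lift_le: "norm (lift x) \<le> 1 + norm (x :: 'a::real_normed_vector)"
  unfolding lift_def using norm_Pair_le[of "1::real" x] by simp

locale bounded_distribution = prob_space F for F :: "'a::euclidean_space measure" +
  fixes R :: real
  assumes sets_F [measurable_cong]: "sets F = sets borel"
    and bounded_AE: "AE x in F. norm x \<le> R"
begin

lemma affine_integrable: "integrable F (\<lambda>x. lift x)"
proof (rule integrable_const_bound[where B = "1 + R"])
  show "AE x in F. norm (lift x) \<le> 1 + R"
    using bounded_AE by eventually_elim (rule order_trans[OF norm_lift_le], simp)
qed measurable

lemma weighted_integrable:
  assumes q: "q \<in> borel_measurable borel" "\<And>x. 0 \<le> q x" "\<And>x. q x \<le> 1"
  shows "integrable F (\<lambda>x. q x *\<^sub>R lift x)"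
proof (rule Bochner_Integration.integrable_bound[OF affine_integrable])
  note q(1)[measurable]
  show "(\<lambda>x. q x *\<^sub>R lift x) \<in> borel_measurable F"
    by measurable
  show "AE x in F. norm (q x *\<^sub>R lift x) \<le> norm (lift x)"
    using q(2,3) by (intro AE_I2) (simp add: mult_left_le_one_le)
qed

lemma weighted_norm_le:
  assumes q: "q \<in> borel_measurable borel" "\<And>x. 0 \<le> q x" "\<And>x. q x \<le> 1"
  shows "norm (\<integral>x. q x *\<^sub>R lift x \<partial>F) \<le> 1 + R"
proof -
  have "norm (\<integral>x. q x *\<^sub>R lift x \<partial>F) \<le> (\<integral>x. norm (q x *\<^sub>R lift x) \<partial>F)"
    by (rule integral_norm_bound)
  also have "\<dots> \<le> (\<integral>x. 1 + R \<partial>F)"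
  proof (rule integral_mono_AE)
    show "integrable F (\<lambda>x. norm (q x *\<^sub>R lift x))"
      by (intro integrable_norm weighted_integrable q)
    show "AE x in F. norm (q x *\<^sub>R lift x) \<le> 1 + R"
      using bounded_AE
    proof eventually_elim
      case (elim x)
      have "norm (q x *\<^sub>R lift x) \<le> norm (lift x)"
        using q(2,3) by (simp add: mult_left_le_one_le)
      also have "\<dots> \<le> 1 + R"
        using norm_lift_le[of x] elim by simp
      finally show ?case .
    qed
  qed simp
  finally show ?thesis
    by (simp add: prob_space)
qed

lemma bound_nonneg: "0 \<le> R"
proof -
  have "AE x in F. 0 \<le> R"
    using bounded_AE by eventually_elim (use norm_ge_zero order_trans in blast)
  then show ?thesis
    by simp
qed

end

text \<open>For directions \<open>w\<close>, the weights concentrated on the maximisers of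
  \<open>w j \<bullet> lift x\<close> attain the integral of the maximum under \<open>F\<close>. The
  indicators of the cells of \<open>r\<close> are merely one choice of weights for \<open>G\<close>,
  so the target reaches at most the integral of the same maximum under \<open>G\<close>. The order
  assumption compares the two.\<close>

lemma approximate_martingale_weights:
  fixes F G :: "'a::euclidean_space measure" and r :: "'a \<Rightarrow> 'a"
  assumes F: "bounded_distribution F R" and G: "bounded_distribution G R"
    and order: "\<And>W :: (real \<times> 'a) set. finite W \<Longrightarrow> W \<noteq> {} \<Longrightarrow>
                  (\<integral>y. Max ((\<lambda>w. w \<bullet> lift y) ` W) \<partial>G) \<le> (\<integral>x. Max ((\<lambda>w. w \<bullet> lift x) ` W) \<partial>F)"
    and r: "r \<in> borel_measurable borel" "finite (range r)" and "0 < \<epsilon>"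
  obtains q where "stochastic_weights (range r) q"
    "(\<Sum>j\<in>range r. norm ((\<integral>x. q j x *\<^sub>R lift x \<partial>F)
        - (\<integral>y. indicator (r -` {j}) y *\<^sub>R lift y \<partial>G))) < \<epsilon>"
proof -
  interpret F: bounded_distribution F R by fact
  interpret G: bounded_distribution G R by fact
  note r(1)[measurable]
  define J where "J = range r"
  have J: "finite J" "J \<noteq> {}"
    using r(2) by (auto simp: J_def)
  define v :: "'a \<Rightarrow> real \<times> 'a" where "v j = (\<integral>y. indicator (r -` {j}) y *\<^sub>R lift y \<partial>G)" for j
  \<comment> \<open>Setting the vectors to zero outside \<open>J\<close> makes convex combinations
    agree as functions on the whole index type.\<close>
  define c :: "('a \<Rightarrow> 'a \<Rightarrow> real) \<Rightarrow> 'a \<Rightarrow> real \<times> 'a" where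
    "c q j = (\<integral>x. (if j \<in> J then q j x else 0) *\<^sub>R lift x \<partial>F)" for q j
  define C where "C = c ` {q. stochastic_weights J q}"
  have weights: "q j \<in> borel_measurable borel" "0 \<le> q j x" "q j x \<le> 1"
    if "stochastic_weights J q" "j \<in> J" for q j x
    using that stochastic_weights_le_1[OF that(1) J(1) that(2)] by (auto simp: stochastic_weights_def)
  have intF: "integrable F (\<lambda>x. q j x *\<^sub>R lift x)" if "stochastic_weights J q" "j \<in> J" for q j
    by (rule F.weighted_integrable) (use weights[OF that] in auto)
  have intG: "integrable G (\<lambda>x. q j x *\<^sub>R lift x)" if "stochastic_weights J q" "j \<in> J" for q j
    by (rule G.weighted_integrable) (use weights[OF that] in auto)
  have ind: "stochastic_weights J (\<lambda>j. indicator (r -` {j}))"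
  proof -
    have "(\<lambda>y. indicator (r -` {j}) y :: real) \<in> borel_measurable borel" for j
    proof -
      have "r -` {j} \<in> sets borel"
        using measurable_sets[OF r(1), of "{j}"] by simp
      then show ?thesis
        by simp
    qed
    moreover have "(\<Sum>j\<in>J. indicator (r -` {j}) x :: real) = 1" for x
    proof -
      have "(\<Sum>j\<in>J. indicator (r -` {j}) x :: real) = (\<Sum>j\<in>J. if j = r x then 1 else 0)"
        by (intro sum.cong) (auto simp: indicator_def)
      then show ?thesis
        using J by (simp add: J_def)
    qed
    ultimately show ?thesis
      by (auto simp: stochastic_weights_def)
  qed
  \<comment> \<open>Each of the \<open>card J\<close> norms will be at most \<open>\<delta>\<close>,
    so their sum is at most half of \<open>\<epsilon>\<close>; this gives the strict
    inequality.\<close>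
  define \<delta> where "\<delta> = \<epsilon> / (2 * card J)"
  have "0 < \<delta>"
    using \<open>0 < \<epsilon>\<close> J by (auto simp: \<delta>_def card_gt_0_iff)
  obtain c0 where "c0 \<in> C" "(\<Sum>j\<in>J. (norm (c0 j - v j))\<^sup>2) < \<delta>\<^sup>2"
  proof (rule convex_family_approximates[where J = J and C = C and v = v and \<epsilon> = "\<delta>\<^sup>2" and R = "1 + R"])
    show "0 < \<delta>\<^sup>2"
      using \<open>0 < \<delta>\<close> by simp
    show "finite J" by fact
  next
    fix c1 c2 and s :: real assume "c1 \<in> C" "c2 \<in> C" and s: "0 \<le> s" "s \<le> 1"
    then obtain q1 q2 where q: "c1 = c q1" "c2 = c q2" "stochastic_weights J q1" "stochastic_weights J q2"
      by (auto simp: C_def)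
    define q where "q j x = (1 - s) * q1 j x + s * q2 j x" for j x
    have "stochastic_weights J q"
      using q(3,4) s unfolding stochastic_weights_def q_def
      by (auto simp: sum.distrib sum_distrib_left[symmetric]
               intro!: borel_measurable_add borel_measurable_times)
    moreover have "c q = (\<lambda>j. (1 - s) *\<^sub>R c1 j + s *\<^sub>R c2 j)"
    proof
      fix j show "c q j = (1 - s) *\<^sub>R c1 j + s *\<^sub>R c2 j"
      proof (cases "j \<in> J")
        case True
        have "c q j = (\<integral>x. (1 - s) *\<^sub>R (q1 j x *\<^sub>R lift x) + s *\<^sub>R (q2 j x *\<^sub>R lift x) \<partial>F)"
          unfolding c_def using True by (simp add: q_def scaleR_add_left)
        also have "\<dots> = (1 - s) *\<^sub>R c1 j + s *\<^sub>R c2 j"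
          unfolding q c_def using True intF[OF q(3) True] intF[OF q(4) True]
          by (subst Bochner_Integration.integral_add) (simp_all del: scaleR_scaleR)
        finally show ?thesis .
      qed (simp add: q c_def)
    qed
    ultimately show "(\<lambda>j. (1 - s) *\<^sub>R c1 j + s *\<^sub>R c2 j) \<in> C"
      by (auto simp: C_def intro!: image_eqI[of _ _ q])
  next
    fix c1 j assume "c1 \<in> C" "j \<in> J"
    then obtain q where "c1 = c q" "stochastic_weights J q"
      by (auto simp: C_def)
    then show "norm (c1 j) \<le> 1 + R"
      using F.weighted_norm_le[of "q j", OF weights[of q j]] \<open>j \<in> J\<close> by (simp add: c_def)
  next
    fix w :: "'a \<Rightarrow> real \<times> 'a"
    have meas: "(\<lambda>x. w j \<bullet> lift x) \<in> borel_measurable borel" for j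
      by measurable
    obtain q where q: "stochastic_weights J q"
      and q_max: "\<And>x. (\<Sum>j\<in>J. q j x * (w j \<bullet> lift x)) = Max ((\<lambda>j. w j \<bullet> lift x) ` J)"
      using argmax_weights[where \<phi> = "\<lambda>j x. w j \<bullet> lift x", OF J meas] by blast
    let ?m = "\<lambda>x. Max ((\<lambda>j. w j \<bullet> lift x) ` J)"
    have comb: "(\<Sum>j\<in>J. w j \<bullet> (\<integral>x. p j x *\<^sub>R lift x \<partial>K)) = (\<integral>x. (\<Sum>j\<in>J. p j x * (w j \<bullet> lift x)) \<partial>K)"
      "integrable K (\<lambda>x. \<Sum>j\<in>J. p j x * (w j \<bullet> lift x))"
      if int: "\<And>j. j \<in> J \<Longrightarrow> integrable K (\<lambda>x. p j x *\<^sub>R lift x)" for K and p :: "'a \<Rightarrow> 'a \<Rightarrow> real"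
    proof -
      have int': "integrable K (\<lambda>x. p j x * (w j \<bullet> lift x))" if "j \<in> J" for j
        using integrable_inner_right[OF int[OF that], of "w j"] by simp
      have "w j \<bullet> (\<integral>x. p j x *\<^sub>R lift x \<partial>K) = (\<integral>x. p j x * (w j \<bullet> lift x) \<partial>K)" if "j \<in> J" for j
        using int[OF that] by (subst integral_inner_right[symmetric]) simp_all
      then have "(\<Sum>j\<in>J. w j \<bullet> (\<integral>x. p j x *\<^sub>R lift x \<partial>K)) = (\<Sum>j\<in>J. \<integral>x. p j x * (w j \<bullet> lift x) \<partial>K)"
        by (intro sum.cong refl)
      also have "\<dots> = (\<integral>x. (\<Sum>j\<in>J. p j x * (w j \<bullet> lift x)) \<partial>K)"
        using int' by (intro Bochner_Integration.integral_sum[symmetric])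
      finally show "(\<Sum>j\<in>J. w j \<bullet> (\<integral>x. p j x *\<^sub>R lift x \<partial>K)) = (\<integral>x. (\<Sum>j\<in>J. p j x * (w j \<bullet> lift x)) \<partial>K)" .
      show "integrable K (\<lambda>x. \<Sum>j\<in>J. p j x * (w j \<bullet> lift x))"
        using int' by (intro Bochner_Integration.integrable_sum)
    qed
    \<comment> \<open>The target is the moment vector of \<open>G\<close> under cell weights; a
      weighted average of the \<open>w j \<bullet> lift y\<close> is at most their maximum.\<close>
    have "(\<Sum>j\<in>J. w j \<bullet> v j) = (\<integral>y. (\<Sum>j\<in>J. indicator (r -` {j}) y * (w j \<bullet> lift y)) \<partial>G)"
      unfolding v_def using comb(1)[of G "\<lambda>j. indicator (r -` {j})", OF intG[OF ind]] .
    also have "\<dots> \<le> (\<integral>y. ?m y \<partial>G)"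
    proof (rule integral_mono)
      show "integrable G (\<lambda>y. \<Sum>j\<in>J. indicator (r -` {j}) y * (w j \<bullet> lift y))"
        by (rule comb(2)[of G "\<lambda>j. indicator (r -` {j})", OF intG[OF ind]])
      show "integrable G ?m"
        using comb(2)[of G q, OF intG[OF q]] by (simp add: q_max)
      show "(\<Sum>j\<in>J. indicator (r -` {j}) y * (w j \<bullet> lift y)) \<le> ?m y" for y
      proof -
        have "(\<Sum>j\<in>J. indicator (r -` {j}) y * (w j \<bullet> lift y)) \<le> (\<Sum>j\<in>J. indicator (r -` {j}) y * ?m y)"
          using J by (intro sum_mono mult_left_mono) auto
        also have "\<dots> = ?m y"
          using ind by (simp add: sum_distrib_right[symmetric] stochastic_weights_def)
        finally show ?thesis .
      qed
    qed
    also have "\<dots> \<le> (\<integral>x. ?m x \<partial>F)"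
      using order[of "w ` J"] J by (simp add: image_image)
    also have "\<dots> = (\<Sum>j\<in>J. w j \<bullet> c q j)"
      using comb(1)[of F q, OF intF[OF q]] by (simp add: q_max c_def)
    finally show "\<exists>c1\<in>C. (\<Sum>j\<in>J. w j \<bullet> v j) \<le> (\<Sum>j\<in>J. w j \<bullet> c1 j)"
      using q by (auto simp: C_def)
  qed
  then obtain q where q: "stochastic_weights J q" and small: "(\<Sum>j\<in>J. (norm (c q j - v j))\<^sup>2) < \<delta>\<^sup>2"
    by (auto simp: C_def)
  have "norm (c q j - v j) \<le> \<delta>" if "j \<in> J" for j
  proof -
    have "(norm (c q j - v j))\<^sup>2 \<le> \<delta>\<^sup>2"
      using member_le_sum[OF that _ J(1), of "\<lambda>j. (norm (c q j - v j))\<^sup>2"] small by simp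
    then show ?thesis
      using \<open>0 < \<delta>\<close> by (simp add: power2_le_iff_abs_le)
  qed
  then have "(\<Sum>j\<in>J. norm (c q j - v j)) \<le> (\<Sum>j\<in>J. \<delta>)"
    by (rule sum_mono)
  also have "\<dots> < \<epsilon>"
    using J \<open>0 < \<epsilon>\<close> by (simp add: \<delta>_def)
  finally have "(\<Sum>j\<in>J. norm ((\<integral>x. q j x *\<^sub>R lift x \<partial>F) - v j)) < \<epsilon>"
    by (simp add: c_def cong: sum.cong)
  then show thesis
    using that[of q] q unfolding J_def v_def by blast
qed

text \<open>\<open>M\<close> is the law of a pair whose first entry follows \<open>F\<close> and
  whose second is \<open>j\<close> with conditional probability \<open>q j x\<close>. It is built as
  a density on the product of counting measure with \<open>F\<close>, with the entries swapped
  afterwards.\<close>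

lemma weighted_law:
  fixes F :: "'a::euclidean_space measure" and J :: "'a set"
  assumes "prob_space F" and sets_F: "sets F = sets borel"
    and J: "finite J" and q: "stochastic_weights J q"
  obtains M :: "('a \<times> 'a) measure" where "prob_space M" "sets M = sets borel"
    "\<And>\<psi> B. \<psi> \<in> borel_measurable borel \<Longrightarrow> (\<And>z. \<bar>\<psi> z\<bar> \<le> B) \<Longrightarrow>
       (\<integral>z. \<psi> z \<partial>M) = (\<Sum>j\<in>J. \<integral>x. q j x * (\<psi> (x, j) :: real) \<partial>F)"
proof -
  interpret F: prob_space F by fact
  note sets_F[measurable_cong]
  let ?P = "count_space J \<Otimes>\<^sub>M F"
  interpret P: finite_measure ?P
    using J by (intro finite_measure_pair_measure finite_measure_count_space F.finite_measure_axioms)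
  interpret C: sigma_finite_measure "count_space J"
    using J by (rule sigma_finite_measure_count_space_finite)
  interpret pair_sigma_finite "count_space J" F ..
  have q': "q j \<in> borel_measurable borel" "0 \<le> q j x" "q j x \<le> 1" if "j \<in> J" for j x
    using that q stochastic_weights_le_1[OF q J that] by (auto simp: stochastic_weights_def)
  have q_meas [measurable]: "(\<lambda>z. q (fst z) (snd z)) \<in> borel_measurable ?P"
    using J q'(1) sets_F
    by (intro measurable_pair_measure_countable1) (auto simp: countable_finite cong: measurable_cong_sets)
  have swap: "(\<lambda>z. (snd z, fst z)) \<in> borel_measurable ?P"
  proof (intro borel_measurable_Pair)
    have "snd \<in> measurable ?P F"
      by (rule measurable_snd)
    then show "snd \<in> borel_measurable ?P"
      by (simp only: measurable_cong_sets[OF refl sets_F])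
    show "fst \<in> borel_measurable ?P"
      using measurable_compose[OF measurable_fst, of "\<lambda>x. x" "count_space J" borel F] by simp
  qed
  define M where "M = distr (density ?P (\<lambda>z. ennreal (q (fst z) (snd z)))) borel (\<lambda>z. (snd z, fst z))"
  have int: "(\<integral>z. \<psi> z \<partial>M) = (\<Sum>j\<in>J. \<integral>x. q j x * \<psi> (x, j) \<partial>F)"
    if \<psi>: "\<psi> \<in> borel_measurable borel" "\<And>z. \<bar>\<psi> z\<bar> \<le> B" for \<psi> :: "'a \<times> 'a \<Rightarrow> real" and B
  proof -
    note \<psi>(1)[measurable] swap[measurable]
    have \<psi>_meas [measurable]: "(\<lambda>z. \<psi> (snd z, fst z)) \<in> borel_measurable ?P"
      using measurable_compose[OF swap \<psi>(1)] .
    have "(\<integral>z. \<psi> z \<partial>M) = (\<integral>z. \<psi> (snd z, fst z) \<partial>density ?P (\<lambda>z. ennreal (q (fst z) (snd z))))"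
      unfolding M_def by (subst integral_distr) simp_all
    also have "\<dots> = (\<integral>z. q (fst z) (snd z) * \<psi> (snd z, fst z) \<partial>?P)"
      using q'(2) by (subst integral_density) (auto intro!: AE_I2 simp: space_pair_measure)
    also have "\<dots> = (\<integral>j. (\<integral>x. q j x * \<psi> (x, j) \<partial>F) \<partial>count_space J)"
    proof (subst integral_fst'[symmetric])
      show "integrable ?P (\<lambda>z. q (fst z) (snd z) * \<psi> (snd z, fst z))"
      proof (rule P.integrable_const_bound[where B = "B"])
        have "\<bar>q j x\<bar> * \<bar>\<psi> (x, j)\<bar> \<le> 1 * B" if "j \<in> J" for j x
          using q'(2,3)[OF that] \<psi>(2)[of "(x, j)"] by (intro mult_mono) auto
        then show "AE z in ?P. norm (q (fst z) (snd z) * \<psi> (snd z, fst z)) \<le> B"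
          by (intro AE_I2) (auto simp: space_pair_measure abs_mult)
      qed measurable
    qed simp
    also have "\<dots> = (\<Sum>j\<in>J. \<integral>x. q j x * \<psi> (x, j) \<partial>F)"
      using J by (rule lebesgue_integral_count_space_finite)
    finally show ?thesis .
  qed
  show thesis
  proof
    show "sets M = sets borel"
      by (simp add: M_def)
    show "prob_space M"
    proof
      have intq: "integrable F (q j)" if "j \<in> J" for j
        using q'[OF that] sets_F
        by (intro F.integrable_const_bound[where B = 1]) (auto cong: measurable_cong_sets)
      have "measure M (space M) = (\<integral>z. 1 \<partial>M)"
        by simp
      also have "\<dots> = (\<Sum>j\<in>J. \<integral>x. q j x \<partial>F)"
        by (subst int[of _ 1]) simp_all
      also have "\<dots> = (\<integral>x. (\<Sum>j\<in>J. q j x) \<partial>F)"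
        using intq by (intro Bochner_Integration.integral_sum[symmetric])
      also have "\<dots> = 1"
        using q by (simp add: stochastic_weights_def F.prob_space)
      finally show "emeasure M (space M) = 1"
        \<comment> \<open>The infinite case is excluded because \<open>measure\<close> would then be
          0.\<close>
        by (cases "emeasure M (space M)") (auto simp: measure_def)
    qed
  qed (use int in blast)
qed

text \<open>The first marginal of every approximating law is exactly \<open>F\<close>; only the
  relation between the coordinates is approximate. The identity \<open>test\<close> collects
  everything the limit retains: it determines the second marginal and, extended from continuous
  functions to indicators, yields the martingale property in integrated form.\<close>

proposition martingale_coupling:
  fixes F G :: "'a::euclidean_space measure"
  assumes F: "bounded_distribution F R" and G: "bounded_distribution G R"
    and order: "\<And>W :: (real \<times> 'a) set. finite W \<Longrightarrow> W \<noteq> {} \<Longrightarrow>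
                  (\<integral>y. Max ((\<lambda>w. w \<bullet> lift y) ` W) \<partial>G) \<le> (\<integral>x. Max ((\<lambda>w. w \<bullet> lift x) ` W) \<partial>F)"
  obtains M :: "('a \<times> 'a) measure" where "prob_space M" "sets M = sets borel"
    "distr M borel fst = F" "distr M borel snd = G"
    "\<And>B b. B \<in> sets borel \<Longrightarrow>
       (\<integral>z. indicator B (snd z) * (fst z \<bullet> b) \<partial>M) = (\<integral>z. indicator B (snd z) * (snd z \<bullet> b) \<partial>M)"
proof -
  interpret F: bounded_distribution F R by fact
  interpret G: bounded_distribution G R by fact
  \<comment> \<open>Truncation is invisible to \<open>G\<close> and makes the approximating simple
    functions uniformly bounded, by \<open>2 * R\<close>, so that the laws below have a common
    bounded support.\<close>
  define cut :: "'a \<Rightarrow> 'a" where "cut y = (if norm y \<le> R then y else 0)" for y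
  have cut_meas: "cut \<in> borel_measurable borel"
    unfolding cut_def by measurable
  have cut_norm: "norm (cut y) \<le> R" for y
    using F.bound_nonneg by (simp add: cut_def)
  have cut_G: "AE y in G. cut y = y"
    using G.bounded_AE by eventually_elim (simp add: cut_def)
  obtain r :: "nat \<Rightarrow> 'a \<Rightarrow> 'a" where r_simple: "\<And>k. simple_function borel (r k)"
    and r_lim: "\<And>y. (\<lambda>k. r k y) \<longlonglongrightarrow> cut y"
    and r_bound: "\<And>k y. dist (r k y) 0 \<le> 2 * dist (cut y) 0"
    using borel_measurable_implies_sequence_metric[OF cut_meas, of 0] by auto
  have r_meas [measurable]: "r k \<in> borel_measurable borel" for k
    by (rule borel_measurable_simple_function) (rule r_simple)
  have r_fin: "finite (range (r k))" for k
    using simple_functionD(1)[OF r_simple[of k]] by simp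
  have r_norm: "norm (r k y) \<le> 2 * R" for k y
    using r_bound[of k y] cut_norm[of y] by simp
  define v :: "nat \<Rightarrow> 'a \<Rightarrow> real \<times> 'a" where
    "v k j = (\<integral>y. indicator (r k -` {j}) y *\<^sub>R lift y \<partial>G)" for k j
  have "\<exists>q. stochastic_weights (range (r k)) q \<and>
      (\<Sum>j\<in>range (r k). norm ((\<integral>x. q j x *\<^sub>R lift x \<partial>F) - v k j)) < inverse (real (Suc k))" for k
    unfolding v_def
  proof (rule approximate_martingale_weights[OF F G order r_meas r_fin])
    show "0 < inverse (real (Suc k))"
      by simp
  qed blast+
  then have "\<exists>q. \<forall>k. stochastic_weights (range (r k)) (q k) \<and>
      (\<Sum>j\<in>range (r k). norm ((\<integral>x. q k j x *\<^sub>R lift x \<partial>F) - v k j)) < inverse (real (Suc k))"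
    by (intro choice allI)
  then obtain q where q: "\<And>k. stochastic_weights (range (r k)) (q k)"
    and q_approx: "\<And>k. (\<Sum>j\<in>range (r k). norm ((\<integral>x. q k j x *\<^sub>R lift x \<partial>F) - v k j)) < inverse (real (Suc k))"
    by blast
  have "\<exists>M :: ('a \<times> 'a) measure. prob_space M \<and> sets M = sets borel \<and>
      (\<forall>\<psi> B. \<psi> \<in> borel_measurable borel \<longrightarrow> (\<forall>z. \<bar>\<psi> z\<bar> \<le> B) \<longrightarrow>
        (\<integral>z. \<psi> z \<partial>M) = (\<Sum>j\<in>range (r k). \<integral>x. q k j x * (\<psi> (x, j) :: real) \<partial>F))" for k
    by (rule weighted_law[OF F.prob_space_axioms F.sets_F r_fin q]) blast
  then have "\<exists>M :: nat \<Rightarrow> ('a \<times> 'a) measure. \<forall>k. prob_space (M k) \<and> sets (M k) = sets borel \<and>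
      (\<forall>\<psi> B. \<psi> \<in> borel_measurable borel \<longrightarrow> (\<forall>z. \<bar>\<psi> z\<bar> \<le> B) \<longrightarrow>
        (\<integral>z. \<psi> z \<partial>M k) = (\<Sum>j\<in>range (r k). \<integral>x. q k j x * (\<psi> (x, j) :: real) \<partial>F))"
    by (intro choice allI)
  then obtain M :: "nat \<Rightarrow> ('a \<times> 'a) measure" where M_prob: "\<And>k. prob_space (M k)"
    and M_sets [measurable_cong]: "\<And>k. sets (M k) = sets borel"
    and M_int: "\<And>k \<psi> B. \<psi> \<in> borel_measurable borel \<Longrightarrow> (\<And>z. \<bar>\<psi> z\<bar> \<le> B) \<Longrightarrow>
        (\<integral>z. \<psi> z \<partial>M k) = (\<Sum>j\<in>range (r k). \<integral>x. q k j x * (\<psi> (x, j) :: real) \<partial>F)"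
    by blast
  have q': "q k j \<in> borel_measurable borel" "0 \<le> q k j x" "q k j x \<le> 1" if "j \<in> range (r k)" for k j x
    using that q[of k] stochastic_weights_le_1[OF q r_fin that] by (auto simp: stochastic_weights_def)
  have M_fst: "AE z in M k. norm (fst z) \<le> R" for k
  proof -
    interpret M: prob_space "M k" by (rule M_prob)
    define N where "N = {z :: 'a \<times> 'a. R < norm (fst z)}"
    have N [measurable]: "N \<in> sets borel"
      unfolding N_def by (intro borel_open open_Collect_less continuous_intros)
    have "(\<integral>z. indicator N z \<partial>M k) = (\<Sum>j\<in>range (r k). \<integral>x. q k j x * indicator N (x, j) \<partial>F)"
      by (rule M_int[of _ 1]) (auto simp: indicator_def)
    also have "\<dots> = 0"
    proof (intro sum.neutral ballI)
      fix j assume "j \<in> range (r k)"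
      have "(\<integral>x. q k j x * indicator N (x, j) \<partial>F) = (\<integral>x. 0 \<partial>F)"
      proof (rule integral_cong_AE)
        show "AE x in F. q k j x * indicator N (x, j) = 0"
          using F.bounded_AE by eventually_elim (simp add: N_def)
        have "{x :: 'a. R < norm x} \<in> sets borel"
          by (intro borel_open open_Collect_less continuous_intros)
        moreover have "(\<lambda>x. indicator N (x, j) :: real) = indicator {x. R < norm x}"
          by (auto simp: N_def indicator_def)
        ultimately show "(\<lambda>x. q k j x * indicator N (x, j)) \<in> borel_measurable F"
          using q'(1)[OF \<open>j \<in> range (r k)\<close>] F.sets_F
          by (auto intro!: borel_measurable_times cong: measurable_cong_sets)
      qed simp
      then show "(\<integral>x. q k j x * indicator N (x, j) \<partial>F) = 0" by simp
    qed
    finally have "measure (M k) N = 0"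
      using sets_eq_imp_space_eq[OF M_sets[of k]] by simp
    then have "N \<in> null_sets (M k)"
      by (auto simp: null_sets_def M.emeasure_eq_measure M_sets)
    then show ?thesis
      by (rule AE_I'[of N]) (auto simp: N_def)
  qed
  \<comment> \<open>The first coordinate contributes \<open>R\<close>, the second, a value of
    \<open>r k\<close>, at most \<open>2 * R\<close>.\<close>
  have M_bounded: "AE z in M k. norm z \<le> 3 * R" for k
  proof -
    interpret M: prob_space "M k" by (rule M_prob)
    define N where "N = {z :: 'a \<times> 'a. 2 * R < norm (snd z)}"
    have N [measurable]: "N \<in> sets borel"
      unfolding N_def by (intro borel_open open_Collect_less continuous_intros)
    have "(\<integral>z. indicator N z \<partial>M k) = (\<Sum>j\<in>range (r k). \<integral>x. q k j x * indicator N (x, j) \<partial>F)"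
      by (rule M_int[of _ 1]) (auto simp: indicator_def)
    also have "\<dots> = 0"
      using r_norm by (intro sum.neutral) (auto simp: N_def not_less)
    finally have "measure (M k) N = 0"
      using sets_eq_imp_space_eq[OF M_sets[of k]] by simp
    then have "N \<in> null_sets (M k)"
      by (auto simp: null_sets_def M.emeasure_eq_measure M_sets)
    then have "AE z in M k. norm (snd z) \<le> 2 * R"
      by (rule AE_I'[of N]) (auto simp: N_def)
    with M_fst show ?thesis
    proof eventually_elim
      case (elim z)
      then show ?case
        using norm_Pair_le[of "fst z" "snd z"] by simp
    qed
  qed
  obtain s N where s: "strict_mono s" and N: "prob_space N" "sets N = sets borel"
    and N_lim: "\<And>f. continuous_on UNIV f \<Longrightarrow> (\<lambda>n. \<integral>x. f x \<partial>M (s n)) \<longlonglongrightarrow> (\<integral>x. (f x :: real) \<partial>N)"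
  proof (rule bounded_support_imp_weakly_convergent_subsequence[OF M_prob M_sets M_bounded])
    fix s N
    assume "strict_mono s" "prob_space N" "sets N = sets borel"
      "\<And>f. continuous_on UNIV f \<Longrightarrow> (\<lambda>n. \<integral>x. f x \<partial>M (s n)) \<longlonglongrightarrow> (\<integral>x. (f x :: real) \<partial>N)"
    then show thesis
      by (rule that)
  qed
  interpret N: prob_space N by fact
  note N(2)[measurable_cong]
  have fst_meas [measurable]: "fst \<in> borel_measurable N" and snd_meas [measurable]: "snd \<in> borel_measurable N"
    using N(2) by (auto cong: measurable_cong_sets simp: borel_prod[symmetric])
  have distr_fst: "distr N borel fst = F"
  proof (rule measure_eqI_continuous)
    show "finite_measure (distr N borel fst)"
      by (intro prob_space.finite_measure N.prob_space_distr) measurable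
    show "finite_measure F" by (rule F.finite_measure_axioms)
    show "sets (distr N borel fst) = sets borel" "sets F = sets borel"
      by (simp_all add: F.sets_F)
    fix f :: "'a \<Rightarrow> real" assume f: "continuous_on UNIV f" "\<And>x. f x \<in> {0..1}"
    have [measurable]: "f \<in> borel_measurable borel"
      using f(1) by (rule borel_measurable_continuous_onI)
    have f_fst: "continuous_on UNIV (\<lambda>z :: 'a \<times> 'a. f (fst z))"
      by (rule continuous_on_compose2[OF f(1)]) (auto intro: continuous_intros)
    \<comment> \<open>The weights sum to 1, so a function of the first coordinate does not see them
      and the sequence is constant.\<close>
    have "(\<integral>z. f (fst z) \<partial>M k) = (\<integral>x. f x \<partial>F)" for k
    proof -
      have intqf: "integrable F (\<lambda>x. q k j x * f x)" if "j \<in> range (r k)" for j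
      proof (rule F.integrable_const_bound[where B = 1])
        show "AE x in F. norm (q k j x * f x) \<le> 1"
          using q'(2,3)[OF that] f(2) by (intro AE_I2) (simp add: abs_mult mult_le_one)
        show "(\<lambda>x. q k j x * f x) \<in> borel_measurable F"
          using q'(1)[OF that] F.sets_F by (auto cong: measurable_cong_sets)
      qed
      have "(\<integral>z. f (fst z) \<partial>M k) = (\<Sum>j\<in>range (r k). \<integral>x. q k j x * f x \<partial>F)"
        using f(2) borel_measurable_continuous_onI[OF f_fst] by (subst M_int[of _ 1]) auto
      also have "\<dots> = (\<integral>x. (\<Sum>j\<in>range (r k). q k j x * f x) \<partial>F)"
        using intqf by (intro Bochner_Integration.integral_sum[symmetric])
      also have "\<dots> = (\<integral>x. f x \<partial>F)"
        using q[of k] by (simp add: sum_distrib_right[symmetric] stochastic_weights_def)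
      finally show ?thesis .
    qed
    then have "(\<lambda>n. \<integral>x. f x \<partial>F) \<longlonglongrightarrow> (\<integral>z. f (fst z) \<partial>N)"
      using N_lim[OF f_fst] by simp
    then have "(\<integral>z. f (fst z) \<partial>N) = (\<integral>x. f x \<partial>F)"
      by (simp add: LIMSEQ_const_iff)
    then show "(\<integral>x. f x \<partial>distr N borel fst) = (\<integral>x. f x \<partial>F)"
      by (subst integral_distr) simp_all
  qed
  \<comment> \<open>On the discrete side \<open>f\<close> is constant on each cell, so both
    integrals are linear in the matched moment vectors and differ by at most
    \<open>norm \<beta>\<close> / (k + 1).\<close>
  have test: "(\<integral>z. f (snd z) * (\<beta> \<bullet> lift (fst z)) \<partial>N) = (\<integral>y. f y * (\<beta> \<bullet> lift y) \<partial>G)"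
    if f: "continuous_on UNIV f" "\<And>x. f x \<in> {0..1}" for f :: "'a \<Rightarrow> real" and \<beta>
  proof -
    have f_meas [measurable]: "f \<in> borel_measurable borel"
      using f(1) by (rule borel_measurable_continuous_onI)
    have f_snd: "continuous_on UNIV (\<lambda>z :: 'a \<times> 'a. f (snd z))"
      by (rule continuous_on_compose2[OF f(1)]) (auto intro: continuous_intros)
    have \<beta>_bound: "\<bar>\<beta> \<bullet> lift x\<bar> \<le> norm \<beta> * (1 + R)" if "norm x \<le> R" for x
    proof -
      have "\<bar>\<beta> \<bullet> lift x\<bar> \<le> norm \<beta> * norm (lift x)"
        by (rule Cauchy_Schwarz_ineq2)
      also have "\<dots> \<le> norm \<beta> * (1 + R)"
        using norm_lift_le[of x] that by (intro mult_left_mono) auto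
      finally show ?thesis .
    qed
    have f_abs: "\<bar>f y\<bar> \<le> 1" for y
      using f(2)[of y] by auto
    have prod_bound: "\<bar>f y * (\<beta> \<bullet> lift x)\<bar> \<le> norm \<beta> * (1 + R)" if "norm x \<le> R" for x y
      using mult_mono[OF f_abs[of y] \<beta>_bound[OF that]] by (simp add: abs_mult)
    \<comment> \<open>\<open>M_int\<close> covers bounded integrands only; the truncation agrees
      with the intended integrand almost everywhere.\<close>
    define \<psi> where "\<psi> z = (if norm (fst z) \<le> R then f (snd z) * (\<beta> \<bullet> lift (fst z)) else 0)" for z
    have \<psi>_meas: "\<psi> \<in> borel_measurable borel"
      unfolding \<psi>_def by (subst borel_prod[symmetric]) measurable
    have \<psi>_bound: "\<bar>\<psi> z\<bar> \<le> norm \<beta> * (1 + R)" for z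
      using prod_bound F.bound_nonneg by (auto simp: \<psi>_def)
    have M_eq: "(\<integral>z. f (snd z) * (\<beta> \<bullet> lift (fst z)) \<partial>M k)
        = (\<Sum>j\<in>range (r k). f j * (\<beta> \<bullet> (\<integral>x. q k j x *\<^sub>R lift x \<partial>F)))" for k
    proof -
      have "(\<integral>z. f (snd z) * (\<beta> \<bullet> lift (fst z)) \<partial>M k) = (\<integral>z. \<psi> z \<partial>M k)"
      proof (rule integral_cong_AE)
        show "AE z in M k. f (snd z) * (\<beta> \<bullet> lift (fst z)) = \<psi> z"
          using M_fst by eventually_elim (simp add: \<psi>_def)
        show "\<psi> \<in> borel_measurable (M k)"
          using \<psi>_meas M_sets by (simp cong: measurable_cong_sets)
        have "(\<lambda>z. f (snd z) * (\<beta> \<bullet> lift (fst z))) \<in> borel_measurable (borel :: ('a \<times> 'a) measure)"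
          by (subst borel_prod[symmetric]) measurable
        then show "(\<lambda>z. f (snd z) * (\<beta> \<bullet> lift (fst z))) \<in> borel_measurable (M k)"
          using M_sets by (simp cong: measurable_cong_sets)
      qed
      also have "\<dots> = (\<Sum>j\<in>range (r k). \<integral>x. q k j x * \<psi> (x, j) \<partial>F)"
        by (rule M_int[OF \<psi>_meas \<psi>_bound])
      also have "\<dots> = (\<Sum>j\<in>range (r k). f j * (\<beta> \<bullet> (\<integral>x. q k j x *\<^sub>R lift x \<partial>F)))"
      proof (intro sum.cong refl)
        fix j assume j: "j \<in> range (r k)"
        note q'(1)[OF j, measurable]
        have int: "integrable F (\<lambda>x. q k j x *\<^sub>R lift x)"
          by (rule F.weighted_integrable) (use q'[OF j] in auto)
        have "(\<integral>x. q k j x * \<psi> (x, j) \<partial>F) = (\<integral>x. f j * (\<beta> \<bullet> (q k j x *\<^sub>R lift x)) \<partial>F)"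
        proof (rule integral_cong_AE)
          show "AE x in F. q k j x * \<psi> (x, j) = f j * (\<beta> \<bullet> (q k j x *\<^sub>R lift x))"
            using F.bounded_AE by eventually_elim (simp add: \<psi>_def)
          show "(\<lambda>x. q k j x * \<psi> (x, j)) \<in> borel_measurable F"
            unfolding \<psi>_def by measurable
        qed measurable
        also have "\<dots> = f j * (\<beta> \<bullet> (\<integral>x. q k j x *\<^sub>R lift x \<partial>F))"
          using int by (subst integral_mult_right_zero) (subst integral_inner_right, simp_all)
        finally show "(\<integral>x. q k j x * \<psi> (x, j) \<partial>F) = f j * (\<beta> \<bullet> (\<integral>x. q k j x *\<^sub>R lift x \<partial>F))" .
      qed
      finally show ?thesis .
    qed
    have G_eq: "(\<integral>y. f (r k y) * (\<beta> \<bullet> lift y) \<partial>G) = (\<Sum>j\<in>range (r k). f j * (\<beta> \<bullet> v k j))" for k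
    proof -
      have int: "integrable G (\<lambda>y. indicator (r k -` {j}) y *\<^sub>R lift y)" for j
      proof (rule G.weighted_integrable)
        have "r k -` {j} \<in> sets borel"
          using measurable_sets[OF r_meas, of "{j}" k] by simp
        then show "(indicator (r k -` {j}) :: 'a \<Rightarrow> real) \<in> borel_measurable borel"
          by simp
      qed auto
      have "f (r k y) * (\<beta> \<bullet> lift y)
          = (\<Sum>j\<in>range (r k). f j * (\<beta> \<bullet> (indicator (r k -` {j}) y *\<^sub>R lift y)))" for y
      proof -
        have "(\<Sum>j\<in>range (r k). f j * (\<beta> \<bullet> (indicator (r k -` {j}) y *\<^sub>R lift y)))
            = (\<Sum>j\<in>range (r k). if j = r k y then f j * (\<beta> \<bullet> lift y) else 0)"
          by (intro sum.cong) (auto simp: indicator_def)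
        then show ?thesis
          using r_fin by simp
      qed
      then have "(\<integral>y. f (r k y) * (\<beta> \<bullet> lift y) \<partial>G)
          = (\<integral>y. (\<Sum>j\<in>range (r k). f j * (\<beta> \<bullet> (indicator (r k -` {j}) y *\<^sub>R lift y))) \<partial>G)"
        by presburger
      also have "\<dots> = (\<Sum>j\<in>range (r k). \<integral>y. f j * (\<beta> \<bullet> (indicator (r k -` {j}) y *\<^sub>R lift y)) \<partial>G)"
        using int by (intro Bochner_Integration.integral_sum integrable_mult_right integrable_inner_right)
      also have "\<dots> = (\<Sum>j\<in>range (r k). f j * (\<beta> \<bullet> v k j))"
        unfolding v_def using int
        by (intro sum.cong refl) (subst integral_mult_right_zero, subst integral_inner_right, simp_all)
      finally show ?thesis .
    qed
    have diff: "norm ((\<integral>z. f (snd z) * (\<beta> \<bullet> lift (fst z)) \<partial>M k) - (\<integral>y. f (r k y) * (\<beta> \<bullet> lift y) \<partial>G))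
        \<le> norm \<beta> * inverse (real (Suc k))" for k
    proof -
      let ?d = "\<lambda>j. (\<integral>x. q k j x *\<^sub>R lift x \<partial>F) - v k j"
      have "norm ((\<integral>z. f (snd z) * (\<beta> \<bullet> lift (fst z)) \<partial>M k) - (\<integral>y. f (r k y) * (\<beta> \<bullet> lift y) \<partial>G))
          = norm (\<Sum>j\<in>range (r k). f j * (\<beta> \<bullet> ?d j))"
        by (simp add: M_eq G_eq sum_subtractf inner_diff_right right_diff_distrib)
      also have "\<dots> \<le> (\<Sum>j\<in>range (r k). norm \<beta> * norm (?d j))"
      proof (rule sum_norm_le)
        fix j
        have "\<bar>f j\<bar> * \<bar>\<beta> \<bullet> ?d j\<bar> \<le> 1 * (norm \<beta> * norm (?d j))"
          using f_abs by (intro mult_mono Cauchy_Schwarz_ineq2) auto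
        then show "norm (f j * (\<beta> \<bullet> ?d j)) \<le> norm \<beta> * norm (?d j)"
          by (simp add: abs_mult)
      qed
      also have "\<dots> = norm \<beta> * (\<Sum>j\<in>range (r k). norm (?d j))"
        by (simp add: sum_distrib_left)
      also have "\<dots> \<le> norm \<beta> * inverse (real (Suc k))"
        using q_approx[of k] by (intro mult_left_mono) auto
      finally show ?thesis .
    qed
    have "(\<lambda>k. norm \<beta> * inverse (real (Suc k))) \<longlonglongrightarrow> norm \<beta> * 0"
      by (intro tendsto_intros LIMSEQ_inverse_real_of_nat)
    then have "(\<lambda>k. norm \<beta> * inverse (real (Suc k))) \<longlonglongrightarrow> 0"
      by simp
    then have lim0: "(\<lambda>k. (\<integral>z. f (snd z) * (\<beta> \<bullet> lift (fst z)) \<partial>M k) - (\<integral>y. f (r k y) * (\<beta> \<bullet> lift y) \<partial>G)) \<longlonglongrightarrow> 0"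
      by (rule Lim_null_comparison[rotated]) (use diff in simp)
    \<comment> \<open>The comparison with the cells evaluates \<open>f\<close> at
      \<open>r k y\<close>; dominated convergence restores the argument \<open>y\<close>.\<close>
    have "(\<lambda>k. \<integral>y. f (r k y) * (\<beta> \<bullet> lift y) \<partial>G) \<longlonglongrightarrow> (\<integral>y. f y * (\<beta> \<bullet> lift y) \<partial>G)"
    proof (rule integral_dominated_convergence[where w = "\<lambda>_. norm \<beta> * (1 + R)"])
      show "(\<lambda>y. f y * (\<beta> \<bullet> lift y)) \<in> borel_measurable G"
        "(\<lambda>y. f (r k y) * (\<beta> \<bullet> lift y)) \<in> borel_measurable G" for k
        by measurable
      show "AE y in G. norm (f (r k y) * (\<beta> \<bullet> lift y)) \<le> norm \<beta> * (1 + R)" for k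
        using G.bounded_AE by eventually_elim (simp add: prod_bound)
      show "AE y in G. (\<lambda>k. f (r k y) * (\<beta> \<bullet> lift y)) \<longlonglongrightarrow> f y * (\<beta> \<bullet> lift y)"
        using cut_G
      proof eventually_elim
        case (elim y)
        have "(\<lambda>k. f (r k y)) \<longlonglongrightarrow> f (cut y)"
          by (rule continuous_on_tendsto_compose[OF f(1) r_lim]) auto
        then show ?case
          using elim by (intro tendsto_intros) simp_all
      qed
    qed simp
    then have "(\<lambda>k. \<integral>z. f (snd z) * (\<beta> \<bullet> lift (fst z)) \<partial>M k) \<longlonglongrightarrow> (\<integral>y. f y * (\<beta> \<bullet> lift y) \<partial>G)"
      using tendsto_add[OF lim0] by fastforce
    then have "(\<lambda>n. \<integral>z. f (snd z) * (\<beta> \<bullet> lift (fst z)) \<partial>M (s n)) \<longlonglongrightarrow> (\<integral>y. f y * (\<beta> \<bullet> lift y) \<partial>G)"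
      using LIMSEQ_subseq_LIMSEQ[OF _ s] by (fastforce simp: o_def)
    moreover have "continuous_on UNIV (\<lambda>z :: 'a \<times> 'a. f (snd z) * (\<beta> \<bullet> lift (fst z)))"
      by (intro continuous_intros f_snd)
    then have "(\<lambda>n. \<integral>z. f (snd z) * (\<beta> \<bullet> lift (fst z)) \<partial>M (s n)) \<longlonglongrightarrow> (\<integral>z. f (snd z) * (\<beta> \<bullet> lift (fst z)) \<partial>N)"
      by (rule N_lim)
    ultimately show ?thesis
      using LIMSEQ_unique by blast
  qed
  have distr_snd: "distr N borel snd = G"
  proof (rule measure_eqI_continuous)
    show "finite_measure (distr N borel snd)"
      by (intro prob_space.finite_measure N.prob_space_distr) measurable
    show "finite_measure G" by (rule G.finite_measure_axioms)
    show "sets (distr N borel snd) = sets borel" "sets G = sets borel"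
      by (simp_all add: G.sets_F)
    fix f :: "'a \<Rightarrow> real" assume f: "continuous_on UNIV f" "\<And>x. f x \<in> {0..1}"
    have [measurable]: "f \<in> borel_measurable borel"
      using f(1) by (rule borel_measurable_continuous_onI)
    \<comment> \<open>The coefficient pair (1, 0) selects the constant 1 from \<open>lift\<close>,
      leaving only the second coordinate.\<close>
    have "(\<integral>z. f (snd z) \<partial>N) = (\<integral>y. f y \<partial>G)"
      using test[OF f, of "(1, 0)"] by (simp add: lift_def)
    then show "(\<integral>x. f x \<partial>distr N borel snd) = (\<integral>x. f x \<partial>G)"
      by (subst integral_distr) simp_all
  qed
  have N_fst: "AE z in N. norm (fst z) \<le> R"
  proof -
    have "AE x in distr N borel fst. norm x \<le> R"
      unfolding distr_fst by (rule F.bounded_AE)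
    then show ?thesis
      by (subst (asm) AE_distr_iff) simp_all
  qed
  have N_snd: "AE z in N. norm (snd z) \<le> R"
  proof -
    have "AE x in distr N borel snd. norm x \<le> R"
      unfolding distr_snd by (rule G.bounded_AE)
    then show ?thesis
      by (subst (asm) AE_distr_iff) simp_all
  qed
  have mart: "(\<integral>z. indicator B (snd z) * (fst z \<bullet> b) \<partial>N) = (\<integral>z. indicator B (snd z) * (snd z \<bullet> b) \<partial>N)"
    if B: "B \<in> sets borel" for B b
  proof -
    note B[measurable]
    \<comment> \<open>Shifting by \<open>c\<close> makes \<open>c + x \<bullet> b\<close> a nonnegative density on the support.\<close>
    define c where "c = R * norm b"
    have c_bound: "\<bar>x \<bullet> b\<bar> \<le> c" if "norm x \<le> R" for x
    proof -
      have "\<bar>x \<bullet> b\<bar> \<le> norm x * norm b"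
        by (rule Cauchy_Schwarz_ineq2)
      also have "\<dots> \<le> c"
        unfolding c_def using that by (intro mult_right_mono) auto
      finally show ?thesis .
    qed
    have lift_c: "(c, b) \<bullet> lift x = c + x \<bullet> b" for x
      by (simp add: lift_def inner_commute)
    \<comment> \<open>The law of the second coordinate reweighted by an affine function of
      \<open>X\<close>. Equality of these measures for the two projections replaces continuous test
      functions by indicators of Borel sets.\<close>
    define m where "m X = distr (density N (\<lambda>z. ennreal (c + X z \<bullet> b))) borel snd" for X :: "'a \<times> 'a \<Rightarrow> 'a"
    have m_int: "(\<integral>y. f y \<partial>m X) = (\<integral>z. f (snd z) * (c + X z \<bullet> b) \<partial>N)"
      if [measurable]: "X \<in> borel_measurable N" "f \<in> borel_measurable borel"
        and X: "AE z in N. norm (X z) \<le> R" for X and f :: "'a \<Rightarrow> real"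
    proof -
      have "(\<integral>y. f y \<partial>m X) = (\<integral>z. f (snd z) \<partial>density N (\<lambda>z. ennreal (c + X z \<bullet> b)))"
        unfolding m_def by (subst integral_distr) simp_all
      also have "\<dots> = (\<integral>z. (c + X z \<bullet> b) *\<^sub>R f (snd z) \<partial>N)"
      proof (rule integral_density)
        show "AE z in N. 0 \<le> c + X z \<bullet> b"
          using X
        proof eventually_elim
          case (elim z)
          then show ?case
            using c_bound[OF elim] by linarith
        qed
      qed measurable
      finally show ?thesis
        by (simp add: mult.commute)
    qed
    have m_fin: "finite_measure (m X)"
      if [measurable]: "X \<in> borel_measurable N" and X: "AE z in N. norm (X z) \<le> R" for X
    proof -
      have "emeasure (density N (\<lambda>z. ennreal (c + X z \<bullet> b))) (space N) = (\<integral>\<^sup>+z. ennreal (c + X z \<bullet> b) * indicator (space N) z \<partial>N)"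
        by (rule emeasure_density) measurable
      also have "\<dots> \<le> (\<integral>\<^sup>+z. ennreal (c + c) \<partial>N)"
      proof (rule nn_integral_mono_AE)
        show "AE z in N. ennreal (c + X z \<bullet> b) * indicator (space N) z \<le> ennreal (c + c)"
          using X
        proof eventually_elim
          case (elim z)
          then show ?case
            using c_bound[OF elim] by (auto simp: indicator_def intro!: ennreal_leI)
        qed
      qed
      also have "\<dots> < \<infinity>"
        by (simp add: N.emeasure_space_1)
      finally have "finite_measure (density N (\<lambda>z. ennreal (c + X z \<bullet> b)))"
        by (intro finite_measureI) simp
      then show ?thesis
        unfolding m_def by (rule finite_measure.finite_measure_distr) measurable
    qed
    have "m fst = m snd"
    proof (rule measure_eqI_continuous)
      show "finite_measure (m fst)" "finite_measure (m snd)"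
        by (rule m_fin; use N_fst N_snd in simp)+
      show "sets (m fst) = sets borel" "sets (m snd) = sets borel"
        by (simp_all add: m_def)
      fix f :: "'a \<Rightarrow> real" assume f: "continuous_on UNIV f" "\<And>x. f x \<in> {0..1}"
      have [measurable]: "f \<in> borel_measurable borel"
        using f(1) by (rule borel_measurable_continuous_onI)
      have "(\<integral>y. f y \<partial>m fst) = (\<integral>y. f y * (c + y \<bullet> b) \<partial>G)"
        using m_int[OF fst_meas _ N_fst, of f] test[OF f, of "(c, b)"] by (simp add: lift_c)
      also have "\<dots> = (\<integral>y. f y * (c + y \<bullet> b) \<partial>distr N borel snd)"
        by (simp add: distr_snd)
      also have "\<dots> = (\<integral>z. f (snd z) * (c + snd z \<bullet> b) \<partial>N)"
        by (subst integral_distr) simp_all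
      also have "\<dots> = (\<integral>y. f y \<partial>m snd)"
        using m_int[OF snd_meas _ N_snd, of f] by simp
      finally show "(\<integral>y. f y \<partial>m fst) = (\<integral>y. f y \<partial>m snd)" .
    qed
    then have eq: "(\<integral>z. indicator B (snd z) * (c + fst z \<bullet> b) \<partial>N) = (\<integral>z. indicator B (snd z) * (c + snd z \<bullet> b) \<partial>N)"
      using m_int[OF fst_meas _ N_fst, of "indicator B"] m_int[OF snd_meas _ N_snd, of "indicator B"] by simp
    have split: "(\<integral>z. indicator B (snd z) * (c + X z \<bullet> b) \<partial>N)
        = (\<integral>z. indicator B (snd z) * c \<partial>N) + (\<integral>z. indicator B (snd z) * (X z \<bullet> b) \<partial>N)"
      if [measurable]: "X \<in> borel_measurable N" and X: "AE z in N. norm (X z) \<le> R" for X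
    proof -
      have "integrable N (\<lambda>z. indicator B (snd z) * c)"
        by (rule N.integrable_const_bound[where B = "\<bar>c\<bar>"]) (auto simp: indicator_def)
      moreover have "integrable N (\<lambda>z. indicator B (snd z) * (X z \<bullet> b))"
      proof (rule N.integrable_const_bound[where B = "c"])
        show "AE z in N. norm (indicator B (snd z) * (X z \<bullet> b)) \<le> c"
          using X
        proof eventually_elim
          case (elim z)
          then show ?case
            using c_bound[OF elim] by (auto simp: indicator_def)
        qed
      qed measurable
      ultimately show ?thesis
        by (simp add: distrib_left)
    qed
    show ?thesis
      using eq split[OF fst_meas N_fst] split[OF snd_meas N_snd] by simp
  qed
  show thesis
    by (rule that[OF N distr_fst distr_snd mart])
qed

section \<open>Distributions over posteriors\<close>

lemma beliefsD:
  assumes "x \<in> beliefs"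
  shows "0 \<le> x $ \<theta>" "x $ \<theta> \<le> 1" "(\<Sum>\<theta>\<in>UNIV. x $ \<theta>) = 1" "norm x \<le> 1"
proof -
  show *: "0 \<le> x $ \<theta>" for \<theta>
    using assms by (simp add: beliefs_def)
  show sum: "(\<Sum>\<theta>\<in>UNIV. x $ \<theta>) = 1"
    using assms by (simp add: beliefs_def)
  show "x $ \<theta> \<le> 1"
    using member_le_sum[of \<theta> UNIV "\<lambda>\<theta>. x $ \<theta>"] * sum by simp
  show "norm x \<le> 1"
    using norm_le_l1_cart[of x] * sum by simp
qed

lemma closed_beliefs: "closed (beliefs :: (real ^ 'n) set)"
  unfolding beliefs_def
  by (intro closed_Collect_conj closed_Collect_all closed_Collect_le closed_Collect_eq continuous_intros)

lemma borel_measurable_vec_lambda: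
  fixes f :: "'i::finite \<Rightarrow> 'b \<Rightarrow> real"
  assumes "\<And>i. f i \<in> borel_measurable M"
  shows "(\<lambda>\<omega>. \<chi> i. f i \<omega>) \<in> borel_measurable M"
proof (subst borel_measurable_euclidean_space, intro ballI)
  fix b :: "real ^ 'i" assume "b \<in> Basis"
  then obtain i where "b = axis i 1"
    by (auto simp: Basis_vec_def)
  then show "(\<lambda>\<omega>. (\<chi> i. f i \<omega>) \<bullet> b) \<in> borel_measurable M"
    using assms by (simp add: inner_axis)
qed

lemma borel_measurable_vec_nth [measurable (raw)]:
  fixes f :: "'b \<Rightarrow> real ^ 'i"
  assumes "f \<in> borel_measurable M"
  shows "(\<lambda>\<omega>. f \<omega> $ i) \<in> borel_measurable M"
  using assms borel_measurable_continuous_onI[of "\<lambda>x :: real ^ 'i. x $ i"]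
  by (auto intro!: measurable_compose[OF assms] continuous_intros)

lemma joint_law_prob_space:
  assumes "\<mu> \<in> beliefs" "dynamic_info_structure T S \<pi>"
  shows "prob_space (joint_law T \<mu> S \<pi>)"
    "sets (joint_law T \<mu> S \<pi>) = sets (count_space UNIV \<Otimes>\<^sub>M signal_paths (periods T) S)"
proof -
  let ?P = "point_measure UNIV (\<lambda>\<theta>. ennreal (\<mu> $ \<theta>))"
  let ?N = "count_space UNIV \<Otimes>\<^sub>M signal_paths (periods T) S :: ('a \<times> (nat \<Rightarrow> 'b)) measure"
  let ?k = "\<lambda>\<theta>. distr (\<pi> \<theta>) ?N (\<lambda>s. (\<theta>, s))"
  have "prob_space ?P"
  proof
    show "emeasure ?P (space ?P) = 1"
      using beliefsD(1,3)[OF assms(1)]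
      by (simp add: emeasure_point_measure_finite space_point_measure sum_ennreal)
  qed
  then have P: "?P \<in> space (prob_algebra (count_space UNIV))"
    by (simp add: space_prob_algebra sets_point_measure)
  have k: "?k \<in> measurable (count_space UNIV) (prob_algebra ?N)"
    unfolding measurable_count_space_eq1
  proof (rule Pi_I)
    fix \<theta>
    have \<pi>: "prob_space (\<pi> \<theta>)" "sets (\<pi> \<theta>) = sets (signal_paths (periods T) S)"
      using assms(2) by (auto simp: dynamic_info_structure_def space_prob_algebra)
    have "(\<lambda>s. (\<theta>, s)) \<in> measurable (\<pi> \<theta>) ?N"
      unfolding measurable_cong_sets[OF \<pi>(2) refl] by (rule measurable_Pair1') simp
    then show "?k \<theta> \<in> space (prob_algebra ?N)"
      by (simp add: space_prob_algebra prob_space.prob_space_distr[OF \<pi>(1)])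
  qed
  show "prob_space (joint_law T \<mu> S \<pi>)"
    unfolding joint_law_def by (rule prob_space_bind'[OF P k])
  show "sets (joint_law T \<mu> S \<pi>) = sets ?N"
    unfolding joint_law_def by (rule sets_bind'[OF P k])
qed

text \<open>For \<open>t\<close> within the horizon the history is a measurable function of the
  whole signal path. This makes the conditional expectation calculus available for
  posteriors.\<close>

lemma history_subalgebra:
  assumes "\<mu> \<in> beliefs" "dynamic_info_structure T S \<pi>" "t \<in> periods T"
  shows "finite_measure_subalgebra (joint_law T \<mu> S \<pi>) (history_algebra T S t)"
proof -
  let ?N = "count_space UNIV \<Otimes>\<^sub>M signal_paths (periods T) S :: ('a \<times> (nat \<Rightarrow> 'b)) measure"
  interpret prob_space "joint_law T \<mu> S \<pi>"
    by (rule joint_law_prob_space[OF assms(1,2)])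
  have "{1..t} \<subseteq> periods T"
    using assms(3) by (auto simp: periods_def intro: order_trans[of "enat _" "enat t"])
  then have "(\<lambda>s. restrict s {1..t}) \<in> measurable (signal_paths (periods T) S) (signal_paths {1..t} S)"
    unfolding signal_paths_def by (rule measurable_restrict_subset)
  then have "(\<lambda>\<omega>. restrict (snd \<omega>) {1..t}) \<in> measurable ?N (signal_paths {1..t} S)"
    by (rule measurable_compose[OF measurable_snd])
  then have "(\<lambda>(\<theta>, s). restrict s {1..t}) \<in> measurable ?N (signal_paths {1..t} S)"
    by (simp add: case_prod_beta)
  then have "sets (history_algebra T S t) \<subseteq> sets ?N"
    unfolding measurable_iff_sets history_algebra_def by (simp add: space_pair_measure)
  then have "subalgebra (joint_law T \<mu> S \<pi>) (history_algebra T S t)"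
    using joint_law_prob_space(2)[OF assms(1,2)] sets_eq_imp_space_eq[OF joint_law_prob_space(2)[OF assms(1,2)]]
    by (simp add: subalgebra_def history_algebra_def space_pair_measure)
  then show ?thesis
    by unfold_locales
qed

text \<open>The coordinates of the posterior are versions chosen separately, so nonnegativity and
  total mass 1 hold only almost surely. The right side of \<open>posterior_law_mean\<close> does not
  depend on \<open>t\<close>; summation over periods relies on this.\<close>

lemma posterior_law_properties:
  fixes \<mu> :: "real ^ 'n" and S :: "nat \<Rightarrow> 's topology"
  assumes "\<mu> \<in> beliefs" "dynamic_info_structure T S \<pi>" "t \<in> periods T"
  shows posterior_law_bounded: "bounded_distribution (posterior_law T \<mu> S \<pi> t) 1"
    and posterior_law_beliefs: "AE x in posterior_law T \<mu> S \<pi> t. x \<in> beliefs"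
    and posterior_law_mean: "(\<integral>x. x $ \<theta> \<partial>posterior_law T \<mu> S \<pi> t)
      = (\<integral>\<omega>. indicator {\<theta>} (fst \<omega>) \<partial>joint_law T \<mu> S \<pi>)"
proof -
  let ?J = "joint_law T \<mu> S \<pi>" and ?H = "history_algebra T S t"
  interpret finite_measure_subalgebra ?J ?H
    by (rule history_subalgebra[OF assms])
  interpret J: prob_space ?J
    by (rule joint_law_prob_space[OF assms(1,2)])
  let ?f = "\<lambda>\<theta> \<omega>. indicator {\<theta>} (fst \<omega>) :: real"
  have f_meas: "?f \<theta> \<in> borel_measurable ?J" for \<theta> :: 'n
    unfolding measurable_cong_sets[OF joint_law_prob_space(2)[OF assms(1,2)] refl]
    by (rule measurable_compose[OF measurable_fst]) simp
  have f_int: "integrable ?J (?f \<theta>)" for \<theta> :: 'n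
    by (rule integrable_const_bound[where B = 1, OF _ f_meas]) (simp add: indicator_def)
  have [measurable]: "posterior T \<mu> S \<pi> t \<in> borel_measurable ?J"
    unfolding posterior_def[abs_def]
    by (intro borel_measurable_vec_lambda) simp
  have "AE \<omega> in ?J. 0 \<le> real_cond_exp ?J ?H (?f \<theta>) \<omega>" for \<theta> :: 'n
    by (rule real_cond_exp_pos[OF _ f_meas]) simp
  then have nonneg: "AE \<omega> in ?J. \<forall>\<theta>::'n. 0 \<le> real_cond_exp ?J ?H (?f \<theta>) \<omega>"
    by (simp add: AE_all_countable)
  have split: "AE \<omega> in ?J. real_cond_exp ?J ?H (\<lambda>\<omega>. \<Sum>\<theta>\<in>UNIV. ?f \<theta> \<omega>) \<omega>
          = (\<Sum>\<theta>\<in>UNIV. real_cond_exp ?J ?H (?f (\<theta>::'n)) \<omega>)"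
    by (rule real_cond_exp_sum[OF f_int])
  have total: "(\<lambda>\<omega> :: 'n \<times> (nat \<Rightarrow> 's). \<Sum>\<theta>\<in>UNIV. ?f \<theta> \<omega>) = (\<lambda>_. 1)"
    by (simp add: indicator_def)
  have "AE \<omega> in ?J. real_cond_exp ?J ?H (\<lambda>_. 1) \<omega> = 1"
    by (rule real_cond_exp_F_meas) auto
  then have sum1: "AE \<omega> in ?J. (\<Sum>\<theta>\<in>UNIV. real_cond_exp ?J ?H (?f (\<theta>::'n)) \<omega>) = 1"
    using split[unfolded total] by eventually_elim simp
  have "AE \<omega> in ?J. posterior T \<mu> S \<pi> t \<omega> \<in> beliefs"
    using nonneg sum1 by eventually_elim (simp add: beliefs_def posterior_def)
  then show beliefs: "AE x in posterior_law T \<mu> S \<pi> t. x \<in> beliefs"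
    unfolding posterior_law_def
    using borel_closed[OF closed_beliefs] by (subst AE_distr_iff) simp_all
  interpret P: prob_space "posterior_law T \<mu> S \<pi> t"
    unfolding posterior_law_def by (rule J.prob_space_distr) measurable
  show "bounded_distribution (posterior_law T \<mu> S \<pi> t) 1"
  proof
    show "sets (posterior_law T \<mu> S \<pi> t) = sets borel"
      by (simp add: posterior_law_def)
    show "AE x in posterior_law T \<mu> S \<pi> t. norm x \<le> 1"
      using beliefs by eventually_elim (rule beliefsD)
  qed
  have "(\<integral>x. x $ \<theta> \<partial>posterior_law T \<mu> S \<pi> t) = (\<integral>\<omega>. real_cond_exp ?J ?H (?f \<theta>) \<omega> \<partial>?J)"
    unfolding posterior_law_def by (subst integral_distr) (simp_all add: posterior_def)
  also have "\<dots> = (\<integral>\<omega>. ?f \<theta> \<omega> \<partial>?J)"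
    by (rule real_cond_exp_int(2)[OF f_int])
  finally show "(\<integral>x. x $ \<theta> \<partial>posterior_law T \<mu> S \<pi> t) = (\<integral>\<omega>. ?f \<theta> \<omega> \<partial>?J)" .
qed

section \<open>Values of decision problems\<close>

definition support_fun :: "'a::euclidean_space set \<Rightarrow> 'a \<Rightarrow> real" where
  "support_fun S x = (SUP w\<in>S. w \<bullet> x)"

context
  fixes S :: "'a::euclidean_space set" and K :: real
  assumes nonempty: "S \<noteq> {}" and bound: "\<forall>w\<in>S. norm w \<le> K"
begin

lemma support_inner_le: "w \<in> S \<Longrightarrow> \<bar>w \<bullet> x\<bar> \<le> K * norm x"
  by (rule order_trans[OF Cauchy_Schwarz_ineq2]) (intro mult_right_mono bound[rule_format] norm_ge_zero)

lemma support_bdd_above: "bdd_above ((\<lambda>w. w \<bullet> x) ` S)"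
proof (rule bdd_aboveI2)
  show "w \<bullet> x \<le> K * norm x" if "w \<in> S" for w
    using support_inner_le[OF that, of x] by linarith
qed

lemma support_fun_upper: "w \<in> S \<Longrightarrow> w \<bullet> x \<le> support_fun S x"
  unfolding support_fun_def by (rule cSUP_upper[OF _ support_bdd_above])

lemma support_fun_least: "(\<And>w. w \<in> S \<Longrightarrow> w \<bullet> x \<le> c) \<Longrightarrow> support_fun S x \<le> c"
  unfolding support_fun_def by (rule cSUP_least[OF nonempty])

lemma support_fun_abs_le: "\<bar>support_fun S x\<bar> \<le> K * norm x"
proof -
  obtain w where "w \<in> S"
    using nonempty by blast
  then have "- (K * norm x) \<le> support_fun S x"
    using support_inner_le[of w x] support_fun_upper[of w x] by linarith
  moreover have "support_fun S x \<le> K * norm x"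
    using support_inner_le by (intro support_fun_least) (auto simp: abs_le_iff)
  ultimately show ?thesis
    by linarith
qed

text \<open>Each linear function in the supremum is \<open>K\<close>-Lipschitz, hence so is the
  supremum. This gives Borel measurability although \<open>S\<close> may be uncountable.\<close>

lemma continuous_on_support_fun: "continuous_on UNIV (support_fun S)"
proof (rule lipschitz_on_continuous_on)
  have le: "support_fun S x \<le> support_fun S y + K * dist x y" for x y
  proof (rule support_fun_least)
    fix w assume "w \<in> S"
    have "w \<bullet> x = w \<bullet> y + w \<bullet> (x - y)"
      by (simp add: inner_diff_right)
    also have "\<dots> \<le> support_fun S y + K * dist x y"
      using support_fun_upper[OF \<open>w \<in> S\<close>, of y] support_inner_le[OF \<open>w \<in> S\<close>, of "x - y"]
      by (simp add: dist_norm)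
    finally show "w \<bullet> x \<le> support_fun S y + K * dist x y" .
  qed
  show "K-lipschitz_on UNIV (support_fun S)"
  proof (rule lipschitz_onI)
    show "dist (support_fun S x) (support_fun S y) \<le> K * dist x y" for x y
      using le[of x y] le[of y x] by (simp add: dist_real_def dist_commute abs_le_iff)
    obtain w where "w \<in> S"
      using nonempty by blast
    then show "0 \<le> K"
      using bound[rule_format, of w] norm_ge_zero[of w] by linarith
  qed
qed

lemma borel_measurable_support_fun [measurable]: "support_fun S \<in> borel_measurable borel"
  by (rule borel_measurable_continuous_onI[OF continuous_on_support_fun])

lemma support_fun_integrable:
  assumes "bounded_distribution F R"
  shows "integrable F (support_fun S)"
proof -
  interpret F: bounded_distribution F R by fact
  obtain w where "w \<in> S"
    using nonempty by blast
  then have "0 \<le> K"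
    using bound[rule_format, of w] norm_ge_zero[of w] by linarith
  show ?thesis
  proof (rule F.integrable_const_bound[where B = "K * R"])
    show "AE x in F. norm (support_fun S x) \<le> K * R"
      using F.bounded_AE
    proof eventually_elim
      case (elim x)
      have "norm (support_fun S x) \<le> K * norm x"
        using support_fun_abs_le by simp
      also have "\<dots> \<le> K * R"
        using elim \<open>0 \<le> K\<close> by (rule mult_left_mono)
      finally show ?case .
    qed
  qed measurable
qed

end

section \<open>Mean-preserving spreads tested by support functions\<close>

text \<open>Conditional Jensen inequality: \<open>E[h(X) | Y] \<ge> w \<bullet> Y\<close> holds almost surely for countably many
  \<open>w\<close> at once, and a dense set of \<open>w\<close> determines the support function \<open>h\<close>.\<close>

lemma mean_preserving_spread_support_fun:
  fixes F G :: "(real ^ 'n) measure"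
  assumes "F \<succeq> G" and F: "bounded_distribution F R" and G: "bounded_distribution G R"
    and S: "S \<noteq> {}" "\<forall>w\<in>S. norm w \<le> K"
  shows "(\<integral>x. support_fun S x \<partial>G) \<le> (\<integral>x. support_fun S x \<partial>F)"
proof -
  obtain M :: "((real ^ 'n) \<times> (real ^ 'n)) measure" and X Y where "prob_space M"
    and [measurable]: "X \<in> borel_measurable M" "Y \<in> borel_measurable M"
    and FG: "distr M borel X = F" "distr M borel Y = G"
    and int: "\<And>\<theta>. integrable M (\<lambda>\<omega>. X \<omega> $ \<theta>)"
    and mart: "AE \<omega> in M. \<forall>\<theta>. real_cond_exp M (vimage_algebra (space M) Y borel) (\<lambda>\<omega>'. X \<omega>' $ \<theta>) \<omega>
                         = Y \<omega> $ \<theta>"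
    using assms(1) unfolding mean_preserving_spread_def by blast
  interpret M: prob_space M by fact
  let ?A = "vimage_algebra (space M) Y borel" and ?h = "support_fun S"
  note borel_measurable_support_fun[OF S, measurable]
  have "subalgebra M ?A"
    using \<open>Y \<in> borel_measurable M\<close> by (simp add: subalgebra_def measurable_iff_sets)
  then interpret finite_measure_subalgebra M ?A
    by unfold_locales
  have hX: "integrable M (\<lambda>\<omega>. ?h (X \<omega>))"
    using support_fun_integrable[OF S F] unfolding FG(1)[symmetric] by (subst (asm) integrable_distr_eq) simp_all
  have hY: "integrable M (\<lambda>\<omega>. ?h (Y \<omega>))"
    using support_fun_integrable[OF S G] unfolding FG(2)[symmetric] by (subst (asm) integrable_distr_eq) simp_all
  define c where "c = real_cond_exp M ?A (\<lambda>\<omega>. ?h (X \<omega>))"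
  have c: "AE \<omega> in M. w \<bullet> Y \<omega> \<le> c \<omega>" if "w \<in> S" for w
  proof -
    have inner: "w \<bullet> x = (\<Sum>\<theta>\<in>UNIV. w $ \<theta> * x $ \<theta>)" for x
      by (simp add: inner_vec_def)
    have int': "integrable M (\<lambda>\<omega>. w $ \<theta> * X \<omega> $ \<theta>)" for \<theta>
      using int by simp
    have "AE \<omega> in M. real_cond_exp M ?A (\<lambda>\<omega>. w \<bullet> X \<omega>) \<omega> \<le> c \<omega>"
      unfolding c_def
    proof (rule real_cond_exp_mono)
      show "integrable M (\<lambda>\<omega>. w \<bullet> X \<omega>)"
        unfolding inner using int' by (rule Bochner_Integration.integrable_sum)
    qed (use support_fun_upper[OF S that] hX in auto)
    moreover have "AE \<omega> in M. real_cond_exp M ?A (\<lambda>\<omega>. w \<bullet> X \<omega>) \<omega>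
        = (\<Sum>\<theta>\<in>UNIV. real_cond_exp M ?A (\<lambda>\<omega>. w $ \<theta> * X \<omega> $ \<theta>) \<omega>)"
      unfolding inner by (rule real_cond_exp_sum[OF int'])
    moreover have "AE \<omega> in M. \<forall>\<theta>. real_cond_exp M ?A (\<lambda>\<omega>. w $ \<theta> * X \<omega> $ \<theta>) \<omega>
        = w $ \<theta> * real_cond_exp M ?A (\<lambda>\<omega>. X \<omega> $ \<theta>) \<omega>"
      unfolding AE_all_countable using real_cond_exp_cmult[OF int] by blast
    ultimately show ?thesis
      using mart by eventually_elim (simp add: inner)
  qed
  obtain D where D: "countable D" "D \<subseteq> S" "S \<subseteq> closure D"
    by (rule separable)
  have "AE \<omega> in M. \<forall>w\<in>D. w \<bullet> Y \<omega> \<le> c \<omega>"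
    using c D by (intro AE_ball_countable') auto
  then have "AE \<omega> in M. ?h (Y \<omega>) \<le> c \<omega>"
  proof eventually_elim
    case (elim \<omega>)
    have "closure D \<subseteq> {w. Y \<omega> \<bullet> w \<le> c \<omega>}"
      using elim by (intro closure_minimal closed_halfspace_le) (auto simp: inner_commute)
    then show ?case
      using D(3) by (intro support_fun_least[OF S]) (auto simp: inner_commute)
  qed
  then have "(\<integral>\<omega>. ?h (Y \<omega>) \<partial>M) \<le> (\<integral>\<omega>. c \<omega> \<partial>M)"
    using hY real_cond_exp_int(1)[OF hX] by (intro integral_mono_AE) (auto simp: c_def)
  also have "\<dots> = (\<integral>\<omega>. ?h (X \<omega>) \<partial>M)"
    unfolding c_def by (rule real_cond_exp_int(2)[OF hX])
  finally show ?thesis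
    unfolding FG[symmetric] by (subst (1 2) integral_distr) simp_all
qed

text \<open>The coupling needs the order for maxima of affine functions, while decision problems
  give maxima of linear ones. On the simplex the all-ones vector has inner product 1 with every
  belief, so a constant term can be absorbed into the linear part.\<close>

lemma mean_preserving_spread_if_Max:
  fixes F G :: "(real ^ 'n) measure"
  assumes F: "bounded_distribution F 1" "AE x in F. x \<in> beliefs"
    and G: "bounded_distribution G 1" "AE x in G. x \<in> beliefs"
    and order: "\<And>W. finite W \<Longrightarrow> W \<noteq> {} \<Longrightarrow>
                  (\<integral>y. Max ((\<lambda>w. w \<bullet> y) ` W) \<partial>G) \<le> (\<integral>x. Max ((\<lambda>w. w \<bullet> x) ` W) \<partial>F)"
  shows "F \<succeq> G"
proof -
  interpret F: bounded_distribution F 1 by (rule F)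
  interpret G: bounded_distribution G 1 by (rule G)
  have order': "(\<integral>y. Max ((\<lambda>w. w \<bullet> lift y) ` W) \<partial>G) \<le> (\<integral>x. Max ((\<lambda>w. w \<bullet> lift x) ` W) \<partial>F)"
    if W: "finite W" "W \<noteq> {}" for W :: "(real \<times> (real ^ 'n)) set"
  proof -
    define V where "V = (\<lambda>w. snd w + fst w *\<^sub>R 1) ` W"
    have V: "finite V" "V \<noteq> {}"
      using W by (auto simp: V_def)
    have finite_norm: "\<exists>K. \<forall>w\<in>A. norm w \<le> K" if "finite A" for A :: "'b::real_normed_vector set"
      using finite_imp_bounded[OF that] by (simp add: bounded_iff)
    have Max_support: "Max ((\<lambda>w. w \<bullet> x) ` A) = support_fun A x" if "finite A" "A \<noteq> {}"
      for A :: "'b::euclidean_space set" and x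
      unfolding support_fun_def using that by (intro cSup_eq_Max[symmetric]) auto
    have lift_eq: "Max ((\<lambda>w. w \<bullet> lift x) ` W) = Max ((\<lambda>w. w \<bullet> x) ` V)" if "x \<in> beliefs" for x
    proof -
      have "1 \<bullet> x = 1"
        using beliefsD(3)[OF that] by (simp add: inner_vec_def)
      then have "w \<bullet> lift x = (snd w + fst w *\<^sub>R 1) \<bullet> x" for w
        by (simp add: lift_def inner_prod_def inner_add_left)
      then show ?thesis
        by (simp add: V_def image_image)
    qed
    have meas_W: "(\<lambda>x. Max ((\<lambda>w. w \<bullet> lift x) ` W)) \<in> borel_measurable borel"
    proof -
      obtain K where "\<forall>w\<in>W. norm w \<le> K"
        using finite_norm[OF W(1)] by blast
      then have "support_fun W \<in> borel_measurable borel"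
        by (rule borel_measurable_support_fun[OF W(2)])
      then show ?thesis
        using W by (simp add: Max_support measurable_compose[OF measurable_lift])
    qed
    have meas_V: "(\<lambda>x. Max ((\<lambda>w. w \<bullet> x) ` V)) \<in> borel_measurable borel"
    proof -
      obtain K where "\<forall>w\<in>V. norm w \<le> K"
        using finite_norm[OF V(1)] by blast
      then have "support_fun V \<in> borel_measurable borel"
        by (rule borel_measurable_support_fun[OF V(2)])
      then show ?thesis
        using V by (simp add: Max_support)
    qed
    have eq: "(\<integral>x. Max ((\<lambda>w. w \<bullet> lift x) ` W) \<partial>H) = (\<integral>x. Max ((\<lambda>w. w \<bullet> x) ` V) \<partial>H)"
      if "sets H = sets borel" "AE x in H. x \<in> beliefs" for H
    proof (rule integral_cong_AE)
      show "AE x in H. Max ((\<lambda>w. w \<bullet> lift x) ` W) = Max ((\<lambda>w. w \<bullet> x) ` V)"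
        using that(2) by eventually_elim (rule lift_eq)
    qed (use meas_W meas_V that(1) in \<open>simp_all cong: measurable_cong_sets\<close>)
    show ?thesis
      unfolding eq[OF F.sets_F F(2)] eq[OF G.sets_F G(2)] by (rule order[OF V])
  qed
  show ?thesis
  proof (rule martingale_coupling[OF F(1) G(1) order'])
    fix M :: "((real ^ 'n) \<times> (real ^ 'n)) measure"
    assume "prob_space M" and sets_M: "sets M = sets borel"
      and FG: "distr M borel fst = F" "distr M borel snd = G"
      and mart: "\<And>B b. B \<in> sets borel \<Longrightarrow>
       (\<integral>z. indicator B (snd z) * (fst z \<bullet> b) \<partial>M) = (\<integral>z. indicator B (snd z) * (snd z \<bullet> b) \<partial>M)"
    interpret M: prob_space M by fact
    have meas [measurable]: "fst \<in> borel_measurable M" "snd \<in> borel_measurable M"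
      using sets_M by (auto cong: measurable_cong_sets simp: borel_prod[symmetric])
    let ?A = "vimage_algebra (space M) snd (borel :: (real ^ 'n) measure)"
    have "subalgebra M ?A"
      using meas(2) by (simp add: subalgebra_def measurable_iff_sets)
    then interpret finite_measure_subalgebra M ?A
      by unfold_locales
    have "AE x in distr M borel fst. norm x \<le> 1" "AE x in distr M borel snd. norm x \<le> 1"
      unfolding FG by (rule F.bounded_AE G.bounded_AE)+
    then have AE: "AE z in M. norm (fst z) \<le> 1" "AE z in M. norm (snd z) \<le> 1"
      by (simp_all add: AE_distr_iff)
    have int: "integrable M (\<lambda>z. X z $ \<theta>)"
      if [measurable]: "X \<in> borel_measurable M" and X: "AE z in M. norm (X z) \<le> 1"
      for X :: "_ \<Rightarrow> real ^ 'n" and \<theta> :: 'n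
    proof (rule M.integrable_const_bound[where B = 1])
      show "AE z in M. norm (X z $ \<theta>) \<le> 1"
        using X by eventually_elim (use component_le_norm_cart order_trans in fastforce)
    qed measurable
    have "AE z in M. real_cond_exp M ?A (\<lambda>z. fst z $ \<theta>) z = snd z $ \<theta>" for \<theta> :: 'n
    proof (rule real_cond_exp_charact)
      show "integrable M (\<lambda>z. fst z $ \<theta>)" "integrable M (\<lambda>z. snd z $ \<theta>)"
        by (rule int[OF meas(1) AE(1)], rule int[OF meas(2) AE(2)])
      have "snd \<in> measurable ?A borel"
        by (rule measurable_vimage_algebra1) simp
      then show "(\<lambda>z. snd z $ \<theta>) \<in> borel_measurable ?A"
        by (rule measurable_compose) measurable
      \<comment> \<open>Events in the algebra of the second coordinate are preimages of Borel sets,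
        so the integrated martingale identity is exactly the characterisation of conditional
        expectation, read coordinate by coordinate through \<open>axis \<theta> 1\<close>.\<close>
      fix C assume "C \<in> sets ?A"
      then obtain B where B: "B \<in> sets borel" "C = snd -` B \<inter> space M"
        by (auto simp: sets_vimage_algebra2)
      have "(\<integral>z\<in>C. X z $ \<theta> \<partial>M) = (\<integral>z. indicator B (snd z) * (X z \<bullet> axis \<theta> 1) \<partial>M)" for X
        unfolding set_lebesgue_integral_def
        by (intro Bochner_Integration.integral_cong) (auto simp: B indicator_def inner_axis)
      then show "(\<integral>z\<in>C. fst z $ \<theta> \<partial>M) = (\<integral>z\<in>C. snd z $ \<theta> \<partial>M)"
        using mart[OF B(1), of "axis \<theta> 1"] by simp
    qed
    then have "AE z in M. \<forall>\<theta>::'n. real_cond_exp M ?A (\<lambda>z. fst z $ \<theta>) z = snd z $ \<theta>"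
      by (simp add: AE_all_countable)
    then show "F \<succeq> G"
      unfolding mean_preserving_spread_def
      using \<open>prob_space M\<close> meas FG int[OF meas(1) AE(1)] by blast
  qed
qed

section \<open>Payoff vectors, convergence over periods, and test problems\<close>

definition payoffs :: "'a topology \<Rightarrow> ('a \<times> 'n \<Rightarrow> real) \<Rightarrow> (real ^ 'n) set" where
  "payoffs A u = (\<lambda>a. \<chi> \<theta>. u (a, \<theta>)) ` topspace A"

lemma period_value_eq_support_fun: "period_value A u = support_fun (payoffs A u)"
  by (simp add: fun_eq_iff period_value_def support_fun_def payoffs_def image_image inner_vec_def
        mult.commute)

lemma AS_problem_attains:
  assumes "AS_problem T A u" "t \<in> periods T"
  shows AS_problem_attains_sup: "\<exists>b\<in>topspace (A t). \<forall>a\<in>topspace (A t). u t (a, \<theta>) \<le> u t (b, \<theta>)"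
    and AS_problem_attains_inf: "\<exists>b\<in>topspace (A t). \<forall>a\<in>topspace (A t). u t (b, \<theta>) \<le> u t (a, \<theta>)"
proof -
  have "topspace (A t) \<noteq> {}" "compact_space (A t)"
    and cont: "continuous_map (prod_topology (A t) (discrete_topology UNIV)) euclideanreal (u t)"
    using assms by (auto simp: AS_problem_def)
  have "continuous_map (A t) (prod_topology (A t) (discrete_topology UNIV)) (\<lambda>a. (a, \<theta>))"
    by (intro continuous_map_pairedI) auto
  then have "continuous_map (A t) euclideanreal (\<lambda>a. u t (a, \<theta>))"
    using continuous_map_compose[OF _ cont] by (simp add: o_def)
  moreover have "compactin (A t) (topspace (A t))"
    using \<open>compact_space (A t)\<close> by (simp add: compact_space_def)
  ultimately have "compactin euclideanreal ((\<lambda>a. u t (a, \<theta>)) ` topspace (A t))"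
    by (rule image_compactin[rotated])
  then have compact: "compact ((\<lambda>a. u t (a, \<theta>)) ` topspace (A t))"
    by simp
  have nonempty: "(\<lambda>a. u t (a, \<theta>)) ` topspace (A t) \<noteq> {}"
    using \<open>topspace (A t) \<noteq> {}\<close> by simp
  show "\<exists>b\<in>topspace (A t). \<forall>a\<in>topspace (A t). u t (a, \<theta>) \<le> u t (b, \<theta>)"
    using compact_attains_sup[OF compact nonempty] by auto
  show "\<exists>b\<in>topspace (A t). \<forall>a\<in>topspace (A t). u t (b, \<theta>) \<le> u t (a, \<theta>)"
    using compact_attains_inf[OF compact nonempty] by auto
qed

lemma payoffs_bounded:
  fixes u :: "nat \<Rightarrow> 'a \<times> 'n::finite \<Rightarrow> real"
  assumes "AS_problem T A u" "t \<in> periods T"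
  obtains K where "payoffs (A t) (u t) \<noteq> {}" "\<forall>w\<in>payoffs (A t) (u t). norm w \<le> K"
proof -
  obtain hi where hi: "\<And>\<theta> a. a \<in> topspace (A t) \<Longrightarrow> u t (a, \<theta>) \<le> u t (hi \<theta>, \<theta>)"
    using AS_problem_attains_sup[OF assms] by metis
  obtain lo where lo: "\<And>\<theta> a. a \<in> topspace (A t) \<Longrightarrow> u t (lo \<theta>, \<theta>) \<le> u t (a, \<theta>)"
    using AS_problem_attains_inf[OF assms] by metis
  show thesis
  proof
    show "payoffs (A t) (u t) \<noteq> {}"
      using assms by (auto simp: payoffs_def AS_problem_def)
    show "\<forall>w\<in>payoffs (A t) (u t). norm w \<le> (\<Sum>\<theta>\<in>UNIV. \<bar>u t (hi \<theta>, \<theta>)\<bar> + \<bar>u t (lo \<theta>, \<theta>)\<bar>)"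
    proof
      fix w assume "w \<in> payoffs (A t) (u t)"
      then obtain a where a: "a \<in> topspace (A t)" "w = (\<chi> \<theta>. u t (a, \<theta>))"
        by (auto simp: payoffs_def)
      have "norm w \<le> (\<Sum>\<theta>\<in>UNIV. \<bar>u t (a, \<theta>)\<bar>)"
        using norm_le_l1_cart[of w] by (simp add: a)
      also have "\<dots> \<le> (\<Sum>\<theta>\<in>UNIV. \<bar>u t (hi \<theta>, \<theta>)\<bar> + \<bar>u t (lo \<theta>, \<theta>)\<bar>)"
      proof (rule sum_mono)
        fix \<theta> :: 'n
        show "\<bar>u t (a, \<theta>)\<bar> \<le> \<bar>u t (hi \<theta>, \<theta>)\<bar> + \<bar>u t (lo \<theta>, \<theta>)\<bar>"
          using hi[OF a(1), of \<theta>] lo[OF a(1), of \<theta>] by linarith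
      qed
      finally show "norm w \<le> (\<Sum>\<theta>\<in>UNIV. \<bar>u t (hi \<theta>, \<theta>)\<bar> + \<bar>u t (lo \<theta>, \<theta>)\<bar>)" .
    qed
  qed
qed

lemma AS_problem_summable:
  assumes "AS_problem T A u" "\<And>t. t \<in> periods T \<Longrightarrow> a t \<in> topspace (A t)"
  shows "summable (\<lambda>t. if t \<in> periods T then u t (a t, \<theta>) else 0)"
proof -
  \<comment> \<open>The convergence condition of \<open>AS_problem\<close> speaks of extensional
    action paths; restriction leaves the terms inside the horizon unchanged.\<close>
  have "restrict a (periods T) \<in> (\<Pi>\<^sub>E t\<in>periods T. topspace (A t))"
    using assms(2) by auto
  then have "period_summable T (\<lambda>t. u t (restrict a (periods T) t, \<theta>))"
    using assms(1) unfolding AS_problem_def by blast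
  then show ?thesis
    by (simp add: period_summable_def cong: if_cong)
qed

text \<open>Convergence of \<open>\<Sum>\<^sub>t u\<^sub>t(a\<^sub>t, \<theta>)\<close> for the best and for the worst actions at \<open>\<theta>\<close> makes the
  oscillations of \<open>u\<^sub>t(\<cdot>, \<theta>)\<close> absolutely summable. Relative to a fixed action, whose expected utility
  does not depend on the information, the values are therefore absolutely summable.\<close>

lemma period_value_summable:
  fixes F :: "nat \<Rightarrow> (real ^ 'n) measure" and u :: "nat \<Rightarrow> 'a \<times> 'n \<Rightarrow> real"
  assumes AS: "AS_problem T A u"
    and F: "\<And>t. t \<in> periods T \<Longrightarrow> bounded_distribution (F t) 1"
    and beliefs: "\<And>t. t \<in> periods T \<Longrightarrow> AE x in F t. x \<in> beliefs"
    and mean: "\<And>t \<theta>. t \<in> periods T \<Longrightarrow> (\<integral>x. x $ \<theta> \<partial>F t) = m \<theta>"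
  shows "summable (\<lambda>t. if t \<in> periods T then \<integral>x. period_value (A t) (u t) x \<partial>F t else 0)"
proof -
  let ?P = "periods T"
  have "\<exists>hi. \<forall>t\<in>?P. \<forall>\<theta>. hi t \<theta> \<in> topspace (A t) \<and> (\<forall>a\<in>topspace (A t). u t (a, \<theta>) \<le> u t (hi t \<theta>, \<theta>))"
    using AS_problem_attains_sup[OF AS] by metis
  then obtain hi where hi: "\<And>t \<theta>. t \<in> ?P \<Longrightarrow> hi t \<theta> \<in> topspace (A t)"
    "\<And>t \<theta> a. t \<in> ?P \<Longrightarrow> a \<in> topspace (A t) \<Longrightarrow> u t (a, \<theta>) \<le> u t (hi t \<theta>, \<theta>)"
    by blast
  have "\<exists>lo. \<forall>t\<in>?P. \<forall>\<theta>. lo t \<theta> \<in> topspace (A t) \<and> (\<forall>a\<in>topspace (A t). u t (lo t \<theta>, \<theta>) \<le> u t (a, \<theta>))"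
    using AS_problem_attains_inf[OF AS] by metis
  then obtain lo where lo: "\<And>t \<theta>. t \<in> ?P \<Longrightarrow> lo t \<theta> \<in> topspace (A t)"
    "\<And>t \<theta> a. t \<in> ?P \<Longrightarrow> a \<in> topspace (A t) \<Longrightarrow> u t (lo t \<theta>, \<theta>) \<le> u t (a, \<theta>)"
    by blast
  define d where "d t \<theta> = (if t \<in> ?P then u t (hi t \<theta>, \<theta>) - u t (lo t \<theta>, \<theta>) else 0)" for t \<theta>
  have d_summable: "summable (\<lambda>t. d t \<theta>)" for \<theta>
  proof -
    have "d t \<theta> = (if t \<in> ?P then u t (hi t \<theta>, \<theta>) else 0) - (if t \<in> ?P then u t (lo t \<theta>, \<theta>) else 0)" for t
      by (simp add: d_def)
    then show ?thesis
      using summable_diff[OF AS_problem_summable[OF AS hi(1)] AS_problem_summable[OF AS lo(1)]] by simp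
  qed
  \<comment> \<open>A reference action, the same in all states; \<open>undefined\<close> merely
    names some state.\<close>
  define b where "b t = hi t undefined" for t
  have b: "b t \<in> topspace (A t)" if "t \<in> ?P" for t
    using hi(1)[OF that] by (simp add: b_def)
  \<comment> \<open>This series may converge only conditionally, so it is split off before the
    comparison test; linearity in the belief reduces it to the common mean \<open>m\<close>.\<close>
  define g where "g t = (\<Sum>\<theta>\<in>UNIV. m \<theta> * (if t \<in> ?P then u t (b t, \<theta>) else 0))" for t
  have g_summable: "summable g"
    unfolding g_def by (intro summable_sum summable_mult AS_problem_summable[OF AS b])
  let ?f = "\<lambda>t. if t \<in> ?P then \<integral>x. period_value (A t) (u t) x \<partial>F t else 0"
  have diff: "norm (?f t - g t) \<le> (\<Sum>\<theta>\<in>UNIV. d t \<theta>)" for t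
  proof (cases "t \<in> ?P")
    case True
    interpret F: bounded_distribution "F t" 1
      by (rule F[OF True])
    obtain K where K: "payoffs (A t) (u t) \<noteq> {}" "\<forall>w\<in>payoffs (A t) (u t). norm w \<le> K"
      by (rule payoffs_bounded[OF AS True])
    let ?V = "period_value (A t) (u t)" and ?w = "(\<chi> \<theta>. u t (b t, \<theta>)) :: real ^ 'n"
    have V_int: "integrable (F t) ?V"
      unfolding period_value_eq_support_fun by (rule support_fun_integrable[OF K F[OF True]])
    have x_int: "integrable (F t) (\<lambda>x. x $ \<theta>)" for \<theta>
    proof (rule F.integrable_const_bound[where B = 1])
      show "AE x in F t. norm (x $ \<theta>) \<le> 1"
        using beliefs[OF True] by eventually_elim (simp add: beliefsD)
    qed measurable
    have w_int: "integrable (F t) (\<lambda>x. ?w \<bullet> x)"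
      unfolding inner_vec_def using x_int by (auto intro!: Bochner_Integration.integrable_sum)
    have "(\<integral>x. ?w \<bullet> x \<partial>F t) = (\<Sum>\<theta>\<in>UNIV. \<integral>x. u t (b t, \<theta>) * x $ \<theta> \<partial>F t)"
      unfolding inner_vec_def using x_int by (subst Bochner_Integration.integral_sum[symmetric]) auto
    also have "\<dots> = g t"
      using True mean[OF True] by (simp add: g_def mult.commute)
    finally have g_eq: "g t = (\<integral>x. ?w \<bullet> x \<partial>F t)" ..
    have bounds: "0 \<le> ?V x - ?w \<bullet> x" "?V x - ?w \<bullet> x \<le> (\<Sum>\<theta>\<in>UNIV. d t \<theta>)" if x: "x \<in> beliefs" for x
    proof -
      have "?w \<in> payoffs (A t) (u t)"
        using b[OF True] by (auto simp: payoffs_def)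
      then show "0 \<le> ?V x - ?w \<bullet> x"
        using support_fun_upper[OF K] by (simp add: period_value_eq_support_fun)
      have "?V x \<le> ?w \<bullet> x + (\<Sum>\<theta>\<in>UNIV. d t \<theta>)"
        unfolding period_value_eq_support_fun
      proof (rule support_fun_least[OF K])
        fix w assume "w \<in> payoffs (A t) (u t)"
        then obtain a where a: "a \<in> topspace (A t)" "w = (\<chi> \<theta>. u t (a, \<theta>))"
          by (auto simp: payoffs_def)
        have "w \<bullet> x - ?w \<bullet> x = (\<Sum>\<theta>\<in>UNIV. (u t (a, \<theta>) - u t (b t, \<theta>)) * x $ \<theta>)"
          by (simp add: a inner_vec_def sum_subtractf left_diff_distrib)
        also have "\<dots> \<le> (\<Sum>\<theta>\<in>UNIV. d t \<theta> * 1)"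
        proof (rule sum_mono)
          fix \<theta> :: 'n
          have "u t (a, \<theta>) - u t (b t, \<theta>) \<le> d t \<theta>" "0 \<le> d t \<theta>"
            using hi(2)[OF True, of _ \<theta>] lo(2)[OF True, of _ \<theta>] a(1) b[OF True] lo(1)[OF True, of \<theta>]
            by (auto simp: d_def True intro: diff_mono)
          then show "(u t (a, \<theta>) - u t (b t, \<theta>)) * x $ \<theta> \<le> d t \<theta> * 1"
            using beliefsD(1,2)[OF x, of \<theta>] by (intro order_trans[OF mult_right_mono mult_left_mono]) auto
        qed
        finally show "w \<bullet> x \<le> ?w \<bullet> x + (\<Sum>\<theta>\<in>UNIV. d t \<theta>)"
          by simp
      qed
      then show "?V x - ?w \<bullet> x \<le> (\<Sum>\<theta>\<in>UNIV. d t \<theta>)"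
        by simp
    qed
    have eq: "?f t - g t = (\<integral>x. ?V x - ?w \<bullet> x \<partial>F t)"
      using True V_int w_int by (simp add: g_eq)
    have int: "integrable (F t) (\<lambda>x. ?V x - ?w \<bullet> x)"
      using V_int w_int by simp
    have "0 \<le> (\<integral>x. ?V x - ?w \<bullet> x \<partial>F t)"
    proof (rule integral_nonneg_AE)
      show "AE x in F t. 0 \<le> ?V x - ?w \<bullet> x"
        using beliefs[OF True] by eventually_elim (rule bounds)
    qed
    moreover have "(\<integral>x. ?V x - ?w \<bullet> x \<partial>F t) \<le> (\<integral>x. (\<Sum>\<theta>\<in>UNIV. d t \<theta>) \<partial>F t)"
    proof (rule integral_mono_AE[OF int])
      show "AE x in F t. ?V x - ?w \<bullet> x \<le> (\<Sum>\<theta>\<in>UNIV. d t \<theta>)"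
        using beliefs[OF True] by eventually_elim (rule bounds)
    qed simp
    ultimately show ?thesis
      unfolding eq by (simp add: F.prob_space)
  qed (simp add: g_def d_def)
  have "summable (\<lambda>t. ?f t - g t)"
    by (rule summable_comparison_test'[where N = 0, OF summable_sum[OF d_summable] diff])
  then show ?thesis
    using summable_add[OF _ g_summable] by fastforce
qed

lemma period_sum_single:
  assumes "t \<in> periods T" "\<And>s. s \<noteq> t \<Longrightarrow> f s = 0"
  shows "period_sum T f = f t"
proof -
  have "(\<lambda>s. if s \<in> periods T then f s else 0) = (\<lambda>s. if s = t then f s else 0)"
    using assms by auto
  then show ?thesis
    using sums_single[of t f] by (simp add: period_sum_def sums_iff)
qed

text \<open>An infinite type contains as many labels as \<open>W\<close> has vectors, so every
  finite maximum is the value of a menu with one action per vector. Discrete topologies make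
  compactness and continuity automatic, and zero utility silences the other periods.\<close>

lemma AS_problem_single_period:
  fixes W :: "(real ^ 'n) set" and T :: enat
  assumes W: "finite W" "W \<noteq> {}" and "infinite (UNIV :: 'a set)"
  obtains A :: "nat \<Rightarrow> 'a topology" and u where "AS_problem T A u"
    "period_value (A t) (u t) = (\<lambda>x. Max ((\<lambda>w. w \<bullet> x) ` W))"
    "\<And>s. s \<noteq> t \<Longrightarrow> period_value (A s) (u s) = (\<lambda>_. 0)"
proof -
  obtain B :: "'a set" where B: "finite B" "card B = card W"
    using infinite_arbitrarily_large[OF assms(3)] by blast
  then obtain h where h: "bij_betw h B W"
    using finite_same_card_bij[OF _ W(1)] by blast
  then have "B \<noteq> {}" "h ` B = W"
    using W(2) by (auto simp: bij_betw_def)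
  define A :: "nat \<Rightarrow> 'a topology" where "A s = discrete_topology B" for s
  define u :: "nat \<Rightarrow> 'a \<times> 'n \<Rightarrow> real" where "u s = (\<lambda>(a, \<theta>). if s = t then h a $ \<theta> else 0)" for s
  show thesis
  proof
    show "AS_problem T A u"
      unfolding AS_problem_def
    proof (intro conjI ballI allI)
      show "topspace (A s) \<noteq> {}" "compact_space (A s)"
        "continuous_map (prod_topology (A s) (discrete_topology UNIV)) euclideanreal (u s)" for s
        using B(1) \<open>B \<noteq> {}\<close>
        by (simp_all add: A_def compact_space_discrete_topology flip: prod_topology_discrete_topology)
      show "period_summable T (\<lambda>s. u s (a s, \<theta>))" for a \<theta>
        unfolding period_summable_def
        by (rule summable_finite[of "{t}"]) (auto simp: u_def)
    qed
    show "period_value (A t) (u t) = (\<lambda>x. Max ((\<lambda>w. w \<bullet> x) ` W))"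
    proof
      fix x
      have "period_value (A t) (u t) x = (SUP a\<in>B. h a \<bullet> x)"
        by (simp add: period_value_def A_def u_def inner_vec_def mult.commute)
      also have "\<dots> = Max ((\<lambda>a. h a \<bullet> x) ` B)"
        using B(1) \<open>B \<noteq> {}\<close> by (intro cSup_eq_Max) auto
      also have "\<dots> = Max ((\<lambda>w. w \<bullet> x) ` W)"
        by (simp add: image_image flip: \<open>h ` B = W\<close>)
      finally show "period_value (A t) (u t) x = Max ((\<lambda>w. w \<bullet> x) ` W)" .
    qed
    show "period_value (A s) (u s) = (\<lambda>_. 0)" if "s \<noteq> t" for s
      using that \<open>B \<noteq> {}\<close> by (simp add: fun_eq_iff period_value_def A_def u_def)
  qed
qed

theorem theorem3p1:
  fixes T :: enat
    and \<mu> :: "real ^ 'n"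
    and S\<^sub>1 :: "nat \<Rightarrow> 's topology" and \<pi>\<^sub>1 :: "'n \<Rightarrow> (nat \<Rightarrow> 's) measure"
    and S\<^sub>2 :: "nat \<Rightarrow> 'r topology" and \<pi>\<^sub>2 :: "'n \<Rightarrow> (nat \<Rightarrow> 'r) measure"
  assumes "1 \<le> T"
    and "\<mu> \<in> rel_interior beliefs"
    and "dynamic_info_structure T S\<^sub>1 \<pi>\<^sub>1"
    and "dynamic_info_structure T S\<^sub>2 \<pi>\<^sub>2"
    and "infinite (UNIV :: 'a set)"
  shows "(\<forall>(A :: nat \<Rightarrow> 'a topology) u. AS_problem T A u \<longrightarrow>
            info_value T \<mu> S\<^sub>1 \<pi>\<^sub>1 A u \<ge> info_value T \<mu> S\<^sub>2 \<pi>\<^sub>2 A u)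
         \<longleftrightarrow> (\<forall>t\<in>periods T. posterior_law T \<mu> S\<^sub>1 \<pi>\<^sub>1 t \<succeq> posterior_law T \<mu> S\<^sub>2 \<pi>\<^sub>2 t)"
proof (intro iffI allI impI ballI)
  let ?F = "posterior_law T \<mu> S\<^sub>1 \<pi>\<^sub>1" and ?G = "posterior_law T \<mu> S\<^sub>2 \<pi>\<^sub>2"
  have \<mu>: "\<mu> \<in> beliefs"
    using assms(2) rel_interior_subset by blast
  note F = posterior_law_properties[OF \<mu> assms(3)] and G = posterior_law_properties[OF \<mu> assms(4)]
  {
    fix t
    assume dominates: "\<forall>(A :: nat \<Rightarrow> 'a topology) u. AS_problem T A u \<longrightarrow>
            info_value T \<mu> S\<^sub>1 \<pi>\<^sub>1 A u \<ge> info_value T \<mu> S\<^sub>2 \<pi>\<^sub>2 A u"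
      and t: "t \<in> periods T"
    show "?F t \<succeq> ?G t"
    proof (rule mean_preserving_spread_if_Max[OF F(1,2)[OF t] G(1,2)[OF t]])
      fix W :: "(real ^ 'n) set" assume W: "finite W" "W \<noteq> {}"
      obtain A :: "nat \<Rightarrow> 'a topology" and u where "AS_problem T A u"
        and val: "period_value (A t) (u t) = (\<lambda>x. Max ((\<lambda>w. w \<bullet> x) ` W))"
        and other: "\<And>s. s \<noteq> t \<Longrightarrow> period_value (A s) (u s) = (\<lambda>_. 0)"
        using AS_problem_single_period[OF W assms(5), of T t] by metis
      then have "info_value T \<mu> S\<^sub>2 \<pi>\<^sub>2 A u \<le> info_value T \<mu> S\<^sub>1 \<pi>\<^sub>1 A u"
        using dominates by blast
      then show "(\<integral>y. Max ((\<lambda>w. w \<bullet> y) ` W) \<partial>?G t) \<le> (\<integral>x. Max ((\<lambda>w. w \<bullet> x) ` W) \<partial>?F t)"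
        \<comment> \<open>Only period \<open>t\<close> contributes, so dominance in this problem is
          the required inequality between two integrals.\<close>
        by (simp add: info_value_def period_sum_single[OF t] other val)
    qed
  next
    fix A :: "nat \<Rightarrow> 'a topology" and u :: "nat \<Rightarrow> 'a \<times> 'n \<Rightarrow> real"
    assume spread: "\<forall>t\<in>periods T. ?F t \<succeq> ?G t" and AS: "AS_problem T A u"
    show "info_value T \<mu> S\<^sub>2 \<pi>\<^sub>2 A u \<le> info_value T \<mu> S\<^sub>1 \<pi>\<^sub>1 A u"
      unfolding info_value_def period_sum_def
    \<comment> \<open>The termwise comparison transfers to the sums because both series converge;
      that is what \<open>period_value_summable\<close> provides for either structure.\<close>
    proof (rule suminf_le)
      fix t
      show "(if t \<in> periods T then \<integral>x. period_value (A t) (u t) x \<partial>?G t else 0)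
          \<le> (if t \<in> periods T then \<integral>x. period_value (A t) (u t) x \<partial>?F t else 0)"
      proof (cases "t \<in> periods T")
        case True
        obtain K where K: "payoffs (A t) (u t) \<noteq> {}" "\<forall>w\<in>payoffs (A t) (u t). norm w \<le> K"
          by (rule payoffs_bounded[OF AS True])
        then show ?thesis
          using True mean_preserving_spread_support_fun[OF spread[rule_format, OF True] F(1)[OF True] G(1)[OF True] K]
          by (simp add: period_value_eq_support_fun)
      qed simp
    qed (rule period_value_summable[OF AS G] period_value_summable[OF AS F]; assumption)+
  }
qed

end
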